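(* Fix an integer $n\ge 2$. The affine Tamari lattice (that is, the poset $\mathsf{ATam}_{\mathsf{Tree}}$ of real TIBITs, equivalently the isomorphic poset $\mathsf{ATam}_{312}$ of $312$-avoiding real TITOs) is a finite lattice, and $\pi^{\downarrow}_{\mathrm{spine}}\colon\mathsf{CTam}_{\mathsf{Tree}}\to\mathsf{ATam}_{\mathsf{Tree}}$ is a surjective lattice homomorphism.
   Context: Fix an integer $n\ge 2$. A translation-invariant total order (TITO) is a total order $\preceq$ on $\mathbb Z$ such that $a\preceq b$ iff $a+n\preceq b+n$. A reflection index is a pair $(a,b)$ of integers with $a<b$, up to simultaneous translation by multiples of $n$; it is an inversion of $\preceq$ if $b\preceq a$, and $\mathrm{Inv}(\preceq)$ is the set of inversions. The Dyer order on TITOs is $\preceq_1\,\le\,\preceq_2$ iff $\mathrm{Inv}(\preceq_1)\subseteq\mathrm{Inv}(\preceq_2)$. A TITO is $312$-avoiding if there are no integers $a<b<c$ with $c\preceq a\preceq b$. A block of a TITO is a nonempty order-convex subset $I\subseteq\mathbb Z$ with no minimal or maximal element such that all intervals $[a,b]$ with $a,b\in I$ are finite; its size is the number of residue classes modulo $n$ it contains; it is waxing if $a\preceq a+n$ for $a\in I$ and waning otherwise. A TITO is real if every block of size $1$ is waxing. $\mathsf{ATam}_{312}$ is the set of $312$-avoiding real TITOs with the Dyer order. A binary tree is a (possibly infinite) plane tree in which each node has at most one left child and at most one right child, each node is the (left or right, not both) child of at most one node (its parent, if it exists), and any two nodes have a common ancestor (each node is an ancestor of itself). The left (right) subtree of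 $v$ consists of the descendants of its left (right) child. In-order: the unique total order on nodes in which, for every $v$, the left subtree of $v$ precedes $v$, which precedes the right subtree of $v$. Post-order: the unique total order in which, for every $v$, the left subtree of $v$ precedes the right subtree of $v$, which precedes $v$. A TIBIT is a binary tree $T$ with node set $\{v_a\mid a\in\mathbb Z\}$ such that $a<b$ iff $v_a$ precedes $v_b$ in in-order, and $v_a$ is the left (resp. right) child of $v_b$ iff $v_{a+n}$ is the left (resp. right) child of $v_{b+n}$. For a TIBIT $T$, $\sqsubseteq_T$ is the TITO obtained by reading node indices in post-order. $\mathsf{CTam}_{\mathsf{Tree}}$ is the set of TIBITs ordered by $T_1\le T_2$ iff $\sqsubseteq_{T_1}\,\le\,\sqsubseteq_{T_2}$ in the Dyer order (it is a finite lattice). A TIBIT is real if there is no integer $k$ such that $v_{k-n}$ is the parent of $v_k$. $\mathsf{ATam}_{\mathsf{Tree}}$ is the subposet of $\mathsf{CTam}_{\mathsf{Tree}}$ consisting of real TIBITs; $T\mapsto\,\sqsubseteq_T$ is an isomorphism $\mathsf{ATam}_{\mathsf{Tree}}\to\mathsf{ATam}_{312}$. The map $\pi^{\downarrow}_{\mathrm{spine}}$: if $T$ is real, $\pi^{\downarrow}_{\mathrm{spine}}(T)=T$. If $T$ is not real, choose $k$ such that $v_{k-n}$ is the parent of $v_k$; then $v_{k+n}$ is the right child of $v_k$, and let $v_{k'}$ be the left child of $v_k$. Then $\pi^{\downarrow}_{\mathrm{spine}}(T)$ is the TIBIT in which, for $j\not\equiv k\pmod n$, the children of $v_j$ are the same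 as in $T$, and for $j=k+mn$ ($m\in\mathbb Z$), the left and right children of $v_j$ are $v_{j-n}$ and $v_{k'+(m+1)n}$, respectively. *)

theory Defs
  imports Main "HOL-Algebra.Lattice"
begin

section \<open>Translation-invariant total orders\<close>

text \<open>A total order \<open>\<preceq>\<close> is a relation \<open>r\<close>, with \<open>(a, b) \<in> r\<close> for \<open>a \<preceq> b\<close>.\<close>

definition tito :: "int \<Rightarrow> int rel \<Rightarrow> bool" where
  "tito n r \<longleftrightarrow> linear_order r \<and> (\<forall>a b. (a, b) \<in> r \<longleftrightarrow> (a + n, b + n) \<in> r)"

text \<open>The class of the pair \<open>(a, b)\<close> up to simultaneous translation by multiples of \<open>n\<close>.\<close>

definition reflection_index :: "int \<Rightarrow> int \<times> int \<Rightarrow> (int \<times> int) set" where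
  "reflection_index n p = {(fst p + m * n, snd p + m * n) | m. True}"

definition Inv :: "int \<Rightarrow> int rel \<Rightarrow> (int \<times> int) set set" where
  "Inv n r = reflection_index n ` {(a, b). a < b \<and> (b, a) \<in> r}"

definition dyer_le :: "int \<Rightarrow> int rel \<Rightarrow> int rel \<Rightarrow> bool" where
  "dyer_le n r s \<longleftrightarrow> Inv n r \<subseteq> Inv n s"

definition avoids_312 :: "int rel \<Rightarrow> bool" where
  "avoids_312 r \<longleftrightarrow> \<not> (\<exists>a b c. a < b \<and> b < c \<and> (c, a) \<in> r \<and> (a, b) \<in> r)"

definition order_interval :: "int rel \<Rightarrow> int \<Rightarrow> int \<Rightarrow> int set" where
  "order_interval r a b = {x. (a, x) \<in> r \<and> (x, b) \<in> r}"

definition block :: "int rel \<Rightarrow> int set \<Rightarrow> bool" where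
  "block r I \<longleftrightarrow>
     I \<noteq> {} \<and>
     (\<forall>a\<in>I. \<forall>b\<in>I. order_interval r a b \<subseteq> I) \<and>
     \<not> (\<exists>m\<in>I. \<forall>x\<in>I. (x, m) \<in> r \<longrightarrow> x = m) \<and>
     \<not> (\<exists>m\<in>I. \<forall>x\<in>I. (m, x) \<in> r \<longrightarrow> x = m) \<and>
     (\<forall>a\<in>I. \<forall>b\<in>I. finite (order_interval r a b))"

definition block_size :: "int \<Rightarrow> int set \<Rightarrow> nat" where
  "block_size n I = card ((\<lambda>a. a mod n) ` I)"

definition waxing :: "int \<Rightarrow> int rel \<Rightarrow> int set \<Rightarrow> bool" where
  "waxing n r I \<longleftrightarrow> (\<forall>a\<in>I. (a, a + n) \<in> r)"

definition real_tito :: "int \<Rightarrow> int rel \<Rightarrow> bool" where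
  "real_tito n r \<longleftrightarrow> (\<forall>I. block r I \<and> block_size n I = 1 \<longrightarrow> waxing n r I)"

definition ATam_312 :: "int \<Rightarrow> int rel gorder" where
  "ATam_312 n = \<lparr>carrier = {r. tito n r \<and> avoids_312 r \<and> real_tito n r},
                 eq = (=), le = dyer_le n\<rparr>"


section \<open>Possibly infinite binary trees\<close>

text \<open>The node set is the whole type; there need not be a root.\<close>

record 'a bintree =
  lchild :: "'a \<Rightarrow> 'a option"
  rchild :: "'a \<Rightarrow> 'a option"

text \<open>Pairs (parent, child).\<close>

definition child_rel :: "'a bintree \<Rightarrow> 'a rel" where
  "child_rel T = {(v, w). lchild T v = Some w \<or> rchild T v = Some w}"

definition descendants :: "'a bintree \<Rightarrow> 'a \<Rightarrow> 'a set" where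
  "descendants T v = {w. (v, w) \<in> (child_rel T)\<^sup>*}"

definition left_subtree :: "'a bintree \<Rightarrow> 'a \<Rightarrow> 'a set" where
  "left_subtree T v = (case lchild T v of None \<Rightarrow> {} | Some w \<Rightarrow> descendants T w)"

definition right_subtree :: "'a bintree \<Rightarrow> 'a \<Rightarrow> 'a set" where
  "right_subtree T v = (case rchild T v of None \<Rightarrow> {} | Some w \<Rightarrow> descendants T w)"

definition binary_tree :: "'a bintree \<Rightarrow> bool" where
  "binary_tree T \<longleftrightarrow>
     (\<forall>u v w. (u, w) \<in> child_rel T \<and> (v, w) \<in> child_rel T \<longrightarrow> u = v) \<and>
     (\<forall>v w. \<not> (lchild T v = Some w \<and> rchild T v = Some w)) \<and>
     acyclic (child_rel T) \<and>
     (\<forall>u v. \<exists>w. u \<in> descendants T w \<and> v \<in> descendants T w)"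

text \<open>
  In a binary tree the sets \<open>left_subtree T v\<close>, \<open>{v}\<close>, \<open>right_subtree T v\<close> are pairwise disjoint,
  so the reflexive relation \<open>r\<close> below expresses strict precedence.
\<close>

definition is_in_order :: "'a bintree \<Rightarrow> 'a rel \<Rightarrow> bool" where
  "is_in_order T r \<longleftrightarrow> linear_order r \<and>
     (\<forall>v. (\<forall>x\<in>left_subtree T v. (x, v) \<in> r) \<and> (\<forall>y\<in>right_subtree T v. (v, y) \<in> r))"

definition is_post_order :: "'a bintree \<Rightarrow> 'a rel \<Rightarrow> bool" where
  "is_post_order T r \<longleftrightarrow> linear_order r \<and>
     (\<forall>v. (\<forall>x\<in>left_subtree T v. \<forall>y\<in>right_subtree T v. (x, y) \<in> r) \<and>
          (\<forall>x\<in>left_subtree T v \<union> right_subtree T v. (x, v) \<in> r))"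

definition in_order :: "'a bintree \<Rightarrow> 'a rel" where
  "in_order T = (THE r. is_in_order T r)"

definition post_order :: "'a bintree \<Rightarrow> 'a rel" where
  "post_order T = (THE r. is_post_order T r)"

subsection \<open>Existence and uniqueness of in-order and post-order\<close>

context
  fixes T :: "'a bintree"
  assumes bt: "binary_tree T"
begin

lemma desc_refl: "v \<in> descendants T v"
  by (simp add: descendants_def)

lemma desc_trans: "u \<in> descendants T v \<Longrightarrow> w \<in> descendants T u \<Longrightarrow> w \<in> descendants T v"
  by (auto simp: descendants_def)

lemma left_down: "u \<in> left_subtree T v \<Longrightarrow> w \<in> descendants T u \<Longrightarrow> w \<in> left_subtree T v"
  by (auto simp: left_subtree_def split: option.splits intro: desc_trans)

lemma right_down: "u \<in> right_subtree T v \<Longrightarrow> w \<in> descendants T u \<Longrightarrow> w \<in> right_subtree T v"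
  by (auto simp: right_subtree_def split: option.splits intro: desc_trans)

lemma desc_cases: "w \<in> descendants T v \<longleftrightarrow> w = v \<or> w \<in> left_subtree T v \<or> w \<in> right_subtree T v"
  unfolding descendants_def left_subtree_def right_subtree_def
  by (auto simp: child_rel_def split: option.splits
      elim: converse_rtranclE intro: converse_rtrancl_into_rtrancl)

lemma desc_antisym: "u \<in> descendants T v \<Longrightarrow> v \<in> descendants T u \<Longrightarrow> u = v"
proof -
  assume "u \<in> descendants T v" "v \<in> descendants T u"
  moreover have "acyclic (child_rel T)" using bt by (simp add: binary_tree_def)
  ultimately show "u = v"
    unfolding descendants_def acyclic_def
    by (metis mem_Collect_eq rtrancl_eq_or_trancl trancl_trans)
qed

lemma desc_child: "(v, w) \<in> child_rel T \<Longrightarrow> v \<notin> descendants T w"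
  using bt by (auto simp: binary_tree_def descendants_def acyclic_def
      dest: rtrancl_into_trancl1)

lemma left_self: "v \<notin> left_subtree T v" and right_self: "v \<notin> right_subtree T v"
  using desc_child by (auto simp: left_subtree_def right_subtree_def child_rel_def split: option.splits)

lemma chain:
  assumes "x \<in> descendants T u" "x \<in> descendants T v"
  shows "u \<in> descendants T v \<or> v \<in> descendants T u"
proof -
  have par: "\<And>a b c. (a, c) \<in> child_rel T \<Longrightarrow> (b, c) \<in> child_rel T \<Longrightarrow> a = b"
    using bt by (auto simp: binary_tree_def)
  have "(u, x) \<in> (child_rel T)\<^sup>*" using assms by (simp add: descendants_def)
  then show ?thesis using assms(2)
  proof (induction rule: rtrancl_induct)
    case base
    then show ?case by simp
  next
    case (step y z)
    show ?case
    proof (cases "z = v")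
      case True
      then show ?thesis using step(1,2) rtrancl_into_rtrancl[of u y "child_rel T" z]
        by (simp add: descendants_def)
    next
      case False
      then obtain y' where "(v, y') \<in> (child_rel T)\<^sup>*" "(y', z) \<in> child_rel T"
        using step(4) by (auto simp: descendants_def elim: rtranclE)
      with par[OF this(2) step(2)] show ?thesis
        using step(3) by (simp add: descendants_def)
    qed
  qed
qed

lemma left_right_disj:
  assumes "x \<in> left_subtree T v" "x \<in> right_subtree T v"
  shows False
proof -
  obtain l r where lr: "lchild T v = Some l" "rchild T v = Some r" "x \<in> descendants T l" "x \<in> descendants T r"
    using assms by (auto simp: left_subtree_def right_subtree_def split: option.splits)
  have ch: "(v, l) \<in> child_rel T" "(v, r) \<in> child_rel T" "l \<noteq> r"
    using lr bt by (auto simp: child_rel_def binary_tree_def)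
  have par: "\<And>a b c. (a, c) \<in> child_rel T \<Longrightarrow> (b, c) \<in> child_rel T \<Longrightarrow> a = b"
    using bt by (auto simp: binary_tree_def)
  have *: False if ab: "a \<in> descendants T b" "(v, a) \<in> child_rel T" "(v, b) \<in> child_rel T" and ne: "a \<noteq> b" for a b
  proof -
    obtain y where "(b, y) \<in> (child_rel T)\<^sup>*" "(y, a) \<in> child_rel T"
      using ab ne unfolding descendants_def by (metis mem_Collect_eq rtranclE)
    with par that(2) have "v \<in> descendants T b" by (auto simp: descendants_def)
    with desc_child that(3) show False by blast
  qed
  show False using chain[OF lr(3,4)] * ch by blast
qed

lemma trichotomy:
  "x = y \<or> x \<in> left_subtree T y \<or> x \<in> right_subtree T y \<or> y \<in> left_subtree T x \<or> y \<in> right_subtree T x \<or>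
   (\<exists>v. x \<in> left_subtree T v \<and> y \<in> right_subtree T v \<or> y \<in> left_subtree T v \<and> x \<in> right_subtree T v)"
proof -
  obtain a where a: "x \<in> descendants T a" "y \<in> descendants T a"
    using bt unfolding binary_tree_def by blast
  have "(a, x) \<in> (child_rel T)\<^sup>*" using a by (simp add: descendants_def)
  then show ?thesis using a(2)
  proof (induction rule: converse_rtrancl_induct)
    case base
    then show ?case using desc_cases[of y x] by blast
  next
    case (step u w)
    have xw: "x \<in> descendants T w" using step(2) by (simp add: descendants_def)
    have w: "descendants T w = left_subtree T u \<or> descendants T w = right_subtree T u"
      using step(1) by (auto simp: child_rel_def left_subtree_def right_subtree_def)
    show ?case
    proof (cases "y \<in> descendants T w")
      case True
      then show ?thesis using step(3) by blast
    next
      case False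
      then have "y = u \<or> y \<in> left_subtree T u \<or> y \<in> right_subtree T u" using step(4) desc_cases[of y u] by blast
      then show ?thesis using w xw False by auto
    qed
  qed
qed

definition post_rel :: "'a rel" where
  "post_rel = {(x, y). x \<in> descendants T y \<or> (\<exists>v. x \<in> left_subtree T v \<and> y \<in> right_subtree T v)}"

definition in_rel :: "'a rel" where
  "in_rel = {(x, y). \<exists>v. (x = v \<or> x \<in> left_subtree T v) \<and> (y = v \<or> y \<in> right_subtree T v)}"

lemma left_desc: "x \<in> left_subtree T v \<Longrightarrow> x \<in> descendants T v" and right_desc: "x \<in> right_subtree T v \<Longrightarrow> x \<in> descendants T v"
  by (simp_all add: desc_cases)

lemma related:
  assumes "y \<in> descendants T v" "y \<in> descendants T w"
  shows "v = w \<or> v \<in> left_subtree T w \<or> v \<in> right_subtree T w \<or> w \<in> left_subtree T v \<or> w \<in> right_subtree T v"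
  using chain[OF assms] by (auto simp: desc_cases)

lemma post_linear: "linear_order post_rel"
proof -
  have "refl_on UNIV post_rel"
    by (auto simp: refl_on_def post_rel_def desc_refl)
  moreover have "trans post_rel"
  proof (rule transI)
    fix x y z assume "(x, y) \<in> post_rel" "(y, z) \<in> post_rel"
    then consider "x \<in> descendants T y" "y \<in> descendants T z" | v where "x \<in> descendants T y" "y \<in> left_subtree T v" "z \<in> right_subtree T v"
      | v where "x \<in> left_subtree T v" "y \<in> right_subtree T v" "y \<in> descendants T z"
      | v w where "x \<in> left_subtree T v" "y \<in> right_subtree T v" "y \<in> left_subtree T w" "z \<in> right_subtree T w"
      unfolding post_rel_def by blast
    then show "(x, z) \<in> post_rel"
    proof cases
      case 1
      then show ?thesis by (auto simp: post_rel_def intro: desc_trans)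
    next
      case 2
      then show ?thesis by (auto simp: post_rel_def intro: left_down)
    next
      case 3
      then have "v \<in> descendants T z \<or> z \<in> descendants T v" using chain right_desc by blast
      then show ?thesis
      proof
        assume "v \<in> descendants T z"
        then show ?thesis using 3 by (auto simp: post_rel_def intro: desc_trans left_desc)
      next
        assume "z \<in> descendants T v"
        then have "z = v \<or> z \<in> left_subtree T v \<or> z \<in> right_subtree T v" by (simp add: desc_cases)
        moreover have "z \<notin> left_subtree T v" using 3 left_down left_right_disj by blast
        ultimately show ?thesis using 3(1) by (auto simp: post_rel_def intro: left_desc)
      qed
    next
      case 4
      from 4 have d: "y \<in> descendants T v" "y \<in> descendants T w" "x \<in> descendants T v" "z \<in> descendants T w"
        by (auto intro: left_desc right_desc)
      have res: "(x, z) \<in> post_rel" if "x \<in> left_subtree T u" "z \<in> right_subtree T u" for u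
        using that by (auto simp: post_rel_def)
      from related[OF d(1,2)] show ?thesis
      proof (elim disjE)
        assume "v = w" then show ?thesis using 4 left_right_disj by blast
      next
        assume "v \<in> left_subtree T w" then show ?thesis using res[of w] left_down d 4 by blast
      next
        assume "v \<in> right_subtree T w" then have "y \<in> right_subtree T w" using right_down d by blast
        then show ?thesis using left_right_disj 4 by blast
      next
        assume "w \<in> left_subtree T v" then have "y \<in> left_subtree T v" using left_down d by blast
        then show ?thesis using left_right_disj 4 by blast
      next
        assume "w \<in> right_subtree T v" then show ?thesis using res[of v] right_down d 4 by blast
      qed
    qed
  qed
  moreover have "antisym post_rel"
  proof (rule antisymI)
    fix x y assume "(x, y) \<in> post_rel" "(y, x) \<in> post_rel"
    then consider "x \<in> descendants T y" "y \<in> descendants T x" | v where "x \<in> descendants T y" "y \<in> left_subtree T v" "x \<in> right_subtree T v"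
      | v where "x \<in> left_subtree T v" "y \<in> right_subtree T v" "y \<in> descendants T x"
      | v w where "x \<in> left_subtree T v" "y \<in> right_subtree T v" "y \<in> left_subtree T w" "x \<in> right_subtree T w"
      unfolding post_rel_def by blast
    then show "x = y"
    proof cases
      case 1
      then show ?thesis using desc_antisym by blast
    next
      case 2
      then show ?thesis using left_down left_right_disj by blast
    next
      case 3
      then show ?thesis using left_down left_right_disj by blast
    next
      case 4
      from 4 have d: "y \<in> descendants T v" "y \<in> descendants T w" "x \<in> descendants T v" "x \<in> descendants T w"
        by (auto intro: left_desc right_desc)
      from related[OF d(1,2)] have False
      proof (elim disjE)
        assume "v = w" then show False using 4 left_right_disj by blast
      next
        assume "v \<in> left_subtree T w" then show False using left_down d 4 left_right_disj by blast
      next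
        assume "v \<in> right_subtree T w" then show False using right_down d 4 left_right_disj by blast
      next
        assume "w \<in> left_subtree T v" then show False using left_down d 4 left_right_disj by blast
      next
        assume "w \<in> right_subtree T v" then show False using right_down d 4 left_right_disj by blast
      qed
      then show ?thesis ..
    qed
  qed
  moreover have "(x, y) \<in> post_rel \<or> (y, x) \<in> post_rel" for x y
    using trichotomy[of x y] desc_refl[of x] left_desc[of x y] right_desc[of x y]
      left_desc[of y x] right_desc[of y x]
    by (auto simp: post_rel_def)
  then have "total_on UNIV post_rel" by (simp add: total_on_def)
  ultimately show ?thesis
    by (simp add: linear_order_on_def partial_order_on_def preorder_on_def)
qed

lemma in_linear: "linear_order in_rel"
proof -
  have "refl_on UNIV in_rel"
    by (auto simp: refl_on_def in_rel_def)
  moreover have "trans in_rel"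
  proof (rule transI)
    fix x y z assume "(x, y) \<in> in_rel" "(y, z) \<in> in_rel"
    then obtain v w where vw: "x = v \<or> x \<in> left_subtree T v" "y = v \<or> y \<in> right_subtree T v"
        "y = w \<or> y \<in> left_subtree T w" "z = w \<or> z \<in> right_subtree T w"
      unfolding in_rel_def by blast
    have d: "y \<in> descendants T v" "y \<in> descendants T w" "x \<in> descendants T v" "z \<in> descendants T w"
      using vw by (auto simp: desc_cases)
    from related[OF d(1,2)] show "(x, z) \<in> in_rel"
    proof (elim disjE)
      assume "v = w" then show ?thesis using vw unfolding in_rel_def by blast
    next
      assume "v \<in> left_subtree T w"
      then have "x \<in> left_subtree T w" using d left_down by blast
      then show ?thesis using vw unfolding in_rel_def by blast
    next
      assume "v \<in> right_subtree T w"
      then have "y \<in> right_subtree T w" using d right_down by blast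
      then show ?thesis using vw left_right_disj right_self by blast
    next
      assume "w \<in> left_subtree T v"
      then have "y \<in> left_subtree T v" using d left_down by blast
      then show ?thesis using vw left_right_disj left_self by blast
    next
      assume "w \<in> right_subtree T v"
      then have "z \<in> right_subtree T v" using d right_down by blast
      then show ?thesis using vw unfolding in_rel_def by blast
    qed
  qed
  moreover have "antisym in_rel"
  proof (rule antisymI)
    fix x y assume "(x, y) \<in> in_rel" "(y, x) \<in> in_rel"
    then obtain v w where vw: "x = v \<or> x \<in> left_subtree T v" "y = v \<or> y \<in> right_subtree T v"
        "y = w \<or> y \<in> left_subtree T w" "x = w \<or> x \<in> right_subtree T w"
      unfolding in_rel_def by blast
    have d: "y \<in> descendants T v" "y \<in> descendants T w" "x \<in> descendants T v" "x \<in> descendants T w"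
      using vw by (auto simp: desc_cases)
    from related[OF d(1,2)] show "x = y"
    proof (elim disjE)
      assume "v = w" then show ?thesis using vw left_right_disj by blast
    next
      assume "v \<in> left_subtree T w" then have "x \<in> left_subtree T w" using left_down d by blast
      then show ?thesis using vw left_right_disj left_self by blast
    next
      assume "v \<in> right_subtree T w" then have "y \<in> right_subtree T w" using right_down d by blast
      then show ?thesis using vw left_right_disj right_self by blast
    next
      assume "w \<in> left_subtree T v" then have "y \<in> left_subtree T v" using left_down d by blast
      then show ?thesis using vw left_right_disj left_self by blast
    next
      assume "w \<in> right_subtree T v" then have "x \<in> right_subtree T v" using right_down d by blast
      then show ?thesis using vw left_right_disj right_self by blast
    qed
  qed
  moreover have "(x, y) \<in> in_rel \<or> (y, x) \<in> in_rel" for x y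
    using trichotomy[of x y] by (auto simp: in_rel_def)
  then have "total_on UNIV in_rel" by (simp add: total_on_def)
  ultimately show ?thesis
    by (simp add: linear_order_on_def partial_order_on_def preorder_on_def)
qed

lemma linear_order_subset_eq:
  assumes "linear_order r" "linear_order s" "r \<subseteq> s"
  shows "r = s"
proof
  show "r \<subseteq> s" by fact
  show "s \<subseteq> r"
  proof (rule subrelI)
    fix x y assume xy: "(x, y) \<in> s"
    have r: "total r" "refl r" and "antisym s"
      using assms(1,2) by (simp_all add: linear_order_on_def partial_order_on_def preorder_on_def)
    have "x = y" if "(y, x) \<in> r"
      using \<open>antisym s\<close> xy that assms(3) by (meson antisymD subsetD)
    moreover have "(y, y) \<in> r" using r(2) by (simp add: refl_onD)
    ultimately show "(x, y) \<in> r"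
      using r(1) by (metis UNIV_I total_on_def)
  qed
qed

lemma is_post_order_iff: "is_post_order T r \<longleftrightarrow> r = post_rel"
proof
  assume r: "is_post_order T r"
  then have "linear_order r" by (simp add: is_post_order_def)
  moreover have "post_rel \<subseteq> r"
  proof (rule subrelI)
    fix x y assume "(x, y) \<in> post_rel"
    then have "x = y \<or> x \<in> left_subtree T y \<or> x \<in> right_subtree T y \<or> (\<exists>v. x \<in> left_subtree T v \<and> y \<in> right_subtree T v)"
      by (auto simp: post_rel_def desc_cases)
    moreover have "(y, y) \<in> r"
      using \<open>linear_order r\<close>
      by (simp add: linear_order_on_def partial_order_on_def preorder_on_def refl_on_def)
    ultimately show "(x, y) \<in> r"
      using r unfolding is_post_order_def by blast
  qed
  ultimately show "r = post_rel"
    using linear_order_subset_eq[OF post_linear] by blast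
next
  assume "r = post_rel"
  then show "is_post_order T r"
    using post_linear by (auto simp: is_post_order_def post_rel_def intro: left_desc right_desc)
qed

lemma is_in_order_iff: "is_in_order T r \<longleftrightarrow> r = in_rel"
proof
  assume r: "is_in_order T r"
  then have lin: "linear_order r" by (simp add: is_in_order_def)
  then have *: "(y, y) \<in> r" and **: "(x, y) \<in> r \<Longrightarrow> (y, z) \<in> r \<Longrightarrow> (x, z) \<in> r" for x y z
    by (auto simp: linear_order_on_def partial_order_on_def preorder_on_def refl_on_def dest: transD)
  have "in_rel \<subseteq> r"
  proof (clarify)
    fix x y assume "(x, y) \<in> in_rel"
    then obtain v where v: "x = v \<or> x \<in> left_subtree T v" "y = v \<or> y \<in> right_subtree T v"
      by (auto simp: in_rel_def)
    then have "(x, v) \<in> r" "(v, y) \<in> r"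
      using r * unfolding is_in_order_def by blast+
    then show "(x, y) \<in> r" by (rule **)
  qed
  then show "r = in_rel"
    using linear_order_subset_eq[OF in_linear lin] by blast
next
  assume "r = in_rel"
  then show "is_in_order T r"
    using in_linear by (auto simp: is_in_order_def in_rel_def)
qed

end

lemma ex1_in_order: "binary_tree T \<Longrightarrow> \<exists>!r. is_in_order T r"
  by (simp add: is_in_order_iff)

lemma ex1_post_order: "binary_tree T \<Longrightarrow> \<exists>!r. is_post_order T r"
  by (simp add: is_post_order_iff)


section \<open>Translation-invariant binary in-ordered trees\<close>

text \<open>The node \<open>v\<^sub>a\<close> is represented by its index \<open>a\<close>.\<close>

definition tibit :: "int \<Rightarrow> int bintree \<Rightarrow> bool" where
  "tibit n T \<longleftrightarrow> binary_tree T \<and>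
     (\<forall>a b. a < b \<longleftrightarrow> (a, b) \<in> in_order T \<and> a \<noteq> b) \<and>
     (\<forall>a b. (lchild T b = Some a \<longleftrightarrow> lchild T (b + n) = Some (a + n)) \<and>
            (rchild T b = Some a \<longleftrightarrow> rchild T (b + n) = Some (a + n)))"

definition real_tibit :: "int \<Rightarrow> int bintree \<Rightarrow> bool" where
  "real_tibit n T \<longleftrightarrow> \<not> (\<exists>k. (k - n, k) \<in> child_rel T)"

definition CTam_Tree :: "int \<Rightarrow> int bintree gorder" where
  "CTam_Tree n = \<lparr>carrier = {T. tibit n T}, eq = (=),
                  le = (\<lambda>T\<^sub>1 T\<^sub>2. dyer_le n (post_order T\<^sub>1) (post_order T\<^sub>2))\<rparr>"

definition ATam_Tree :: "int \<Rightarrow> int bintree gorder" where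
  "ATam_Tree n = (CTam_Tree n)\<lparr>carrier := {T \<in> carrier (CTam_Tree n). real_tibit n T}\<rparr>"

text \<open>
  For a non-real TIBIT, \<open>k\<close> is unique modulo \<open>n\<close> and \<open>v\<^sub>k\<close> has a left child \<open>v\<^bsub>k'\<^esub>\<close>,
  so the value does not depend on the choice.  For \<open>j = k + m n\<close> one has \<open>m = (j - k) div n\<close>.
\<close>

definition pi_spine :: "int \<Rightarrow> int bintree \<Rightarrow> int bintree" where
  "pi_spine n T =
     (if real_tibit n T then T
      else let k = (SOME k. (k - n, k) \<in> child_rel T);
               k' = the (lchild T k)
           in \<lparr>lchild = (\<lambda>j. if j mod n = k mod n then Some (j - n) else lchild T j),
               rchild = (\<lambda>j. if j mod n = k mod n then Some (k' + ((j - k) div n + 1) * n)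
                             else rchild T j)\<rparr>)"


section \<open>Lattices\<close>

definition finite_lattice :: "('a, 'b) gorder_scheme \<Rightarrow> bool" where
  "finite_lattice P \<longleftrightarrow> lattice P \<and> finite (carrier P) \<and> carrier P \<noteq> {}"

text \<open>\<open>join_pres\<close> and \<open>meet_pres\<close> include that both posets are lattices.\<close>

definition lattice_hom :: "('a, 'c) gorder_scheme \<Rightarrow> ('b, 'd) gorder_scheme \<Rightarrow> ('a \<Rightarrow> 'b) \<Rightarrow> bool" where
  "lattice_hom P Q f \<longleftrightarrow> f \<in> carrier P \<rightarrow> carrier Q \<and> join_pres P Q f \<and> meet_pres P Q f"

end

theory Submission
  imports Defs
begin

text \<open>
  The Dyer order compares trees, or orders, through the sets of pairs \<open>a < b\<close> that their orders
  invert.  For the order \<open>\<sqsubseteq>\<close> of a tree these are the pairs for which \<open>b\<close> lies in the right subtree of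
  \<open>a\<close>, and the relations \<open>D\<close> that arise are easily described: \<open>D\<close> is a transitive subrelation of
  \<open><\<close> that is invariant under translation by \<open>n\<close>, and \<open>(a, c) \<in> D\<close> implies \<open>(a, b) \<in> D\<close> for
  \<open>a < b < c\<close>.  Call these Tamari relations.  Both \<open>T \<mapsto> D\<close> on TIBITs and \<open>r \<mapsto> D\<close> on
  312-avoiding TITOs are order isomorphisms onto the Tamari relations under inclusion: \<open>D\<close>
  determines a total order (\<open>ord_of D\<close>), and the tree is recovered as the decreasing tree of that
  order (\<open>tree_of D\<close>), in which \<open>a\<close> is an ancestor of \<open>y\<close> iff \<open>a\<close> comes last among the integers
  from \<open>a\<close> to \<open>y\<close>.

  Tamari relations are closed under intersection, contain a largest element, and are determined by a
  finite window; so they form a finite lattice in which meets are intersections.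

  The right subtree of \<open>a\<close> is infinite iff \<open>(a, a + n) \<in> D\<close>, and otherwise it has at most \<open>n - 1\<close>
  elements.  In either model an object fails to be real exactly when the set of \<open>a\<close> with
  \<open>(a, a + n) \<in> D\<close> is a single residue class, and the map on trees cuts the infinite right subtrees
  of that class down to their first \<open>n - 1\<close> elements; on relations this is \<open>proj\<close>.  It is monotone, idempotent and
  decreasing.  Hence the real relations are closed under joins, they have meets
  \<open>proj (D \<inter> E)\<close>, and \<open>proj\<close> preserves meets.

  The one fact that does not follow formally is that \<open>proj\<close> preserves joins.  Let \<open>u\<close> be the join of
  \<open>proj D\<close> and \<open>proj E\<close>, and suppose that \<open>D \<subseteq> u\<close> fails.  Then \<open>D\<close> has a single infinite class, say
  that of \<open>k\<close>, which still has \<open>n - 1\<close> elements in each of its right subtrees in \<open>u\<close>, and this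
  forces all right subtrees in \<open>u\<close> to be finite.  Making the class of \<open>k\<close> infinite again gives a Tamari relation that contains \<open>D\<close> and \<open>E\<close> and whose
  projection is contained in \<open>u\<close> (\<open>proj_le_join_proj\<close>).
\<close>

section \<open>Lattices presented by families of sets\<close>

text \<open>An order-isomorphic copy, inside the inclusion order, of a poset given by a record: the lattice
  operations are computed in the family \<open>F\<close>, where they need not be union and intersection.\<close>

locale set_model =
  fixes P :: "('a, 'b) gorder_scheme" and \<phi> :: "'a \<Rightarrow> 'c set" and F :: "'c set set"
    and J M :: "'c set \<Rightarrow> 'c set \<Rightarrow> 'c set"
  assumes eq_P: "eq P = (=)"
    and le_P: "\<And>x y. x \<in> carrier P \<Longrightarrow> y \<in> carrier P \<Longrightarrow> le P x y \<longleftrightarrow> \<phi> x \<subseteq> \<phi> y"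
    and bij: "bij_betw \<phi> (carrier P) F"
    and J: "\<And>A B. A \<in> F \<Longrightarrow> B \<in> F \<Longrightarrow> J A B \<in> F \<and> A \<subseteq> J A B \<and> B \<subseteq> J A B"
    and J_least: "\<And>A B C. A \<in> F \<Longrightarrow> B \<in> F \<Longrightarrow> C \<in> F \<Longrightarrow> A \<subseteq> C \<Longrightarrow> B \<subseteq> C \<Longrightarrow> J A B \<subseteq> C"
    and M: "\<And>A B. A \<in> F \<Longrightarrow> B \<in> F \<Longrightarrow> M A B \<in> F \<and> M A B \<subseteq> A \<and> M A B \<subseteq> B"
    and M_greatest: "\<And>A B C. A \<in> F \<Longrightarrow> B \<in> F \<Longrightarrow> C \<in> F \<Longrightarrow> C \<subseteq> A \<Longrightarrow> C \<subseteq> B \<Longrightarrow> C \<subseteq> M A B"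
begin

lemma in_F: "x \<in> carrier P \<Longrightarrow> \<phi> x \<in> F"
  using bij bij_betwE by blast

lemma ex_preimage: "A \<in> F \<Longrightarrow> \<exists>x\<in>carrier P. \<phi> x = A"
  using bij by (auto simp: bij_betw_def)

lemma partial_order: "partial_order P"
proof
  show "x \<in> carrier P \<Longrightarrow> x .=\<^bsub>P\<^esub> x" for x by (simp add: eq_P)
  show "x .=\<^bsub>P\<^esub> y \<Longrightarrow> x \<in> carrier P \<Longrightarrow> y \<in> carrier P \<Longrightarrow> y .=\<^bsub>P\<^esub> x" for x y by (simp add: eq_P)
  show "x .=\<^bsub>P\<^esub> y \<Longrightarrow> y .=\<^bsub>P\<^esub> z \<Longrightarrow> x \<in> carrier P \<Longrightarrow> y \<in> carrier P \<Longrightarrow> z \<in> carrier P \<Longrightarrow> x .=\<^bsub>P\<^esub> z"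
    for x y z by (simp add: eq_P)
  show "x \<in> carrier P \<Longrightarrow> x \<sqsubseteq>\<^bsub>P\<^esub> x" for x by (simp add: le_P)
  show "x \<sqsubseteq>\<^bsub>P\<^esub> y \<Longrightarrow> y \<sqsubseteq>\<^bsub>P\<^esub> x \<Longrightarrow> x \<in> carrier P \<Longrightarrow> y \<in> carrier P \<Longrightarrow> x .=\<^bsub>P\<^esub> y" for x y
    using bij by (simp add: le_P eq_P bij_betw_def inj_on_def)
  show "x \<sqsubseteq>\<^bsub>P\<^esub> y \<Longrightarrow> y \<sqsubseteq>\<^bsub>P\<^esub> z \<Longrightarrow> x \<in> carrier P \<Longrightarrow> y \<in> carrier P \<Longrightarrow> z \<in> carrier P \<Longrightarrow> x \<sqsubseteq>\<^bsub>P\<^esub> z"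
    for x y z using le_P by blast
  show "x .=\<^bsub>P\<^esub> y \<Longrightarrow> z .=\<^bsub>P\<^esub> w \<Longrightarrow> x \<in> carrier P \<Longrightarrow> y \<in> carrier P \<Longrightarrow> z \<in> carrier P \<Longrightarrow> w \<in> carrier P
      \<Longrightarrow> (x \<sqsubseteq>\<^bsub>P\<^esub> z) = (y \<sqsubseteq>\<^bsub>P\<^esub> w)" for x y z w by (simp add: eq_P)
qed (simp add: eq_P)

lemma least_if_J:
  assumes "x \<in> carrier P" "y \<in> carrier P" "s \<in> carrier P" "\<phi> s = J (\<phi> x) (\<phi> y)"
  shows "least P s (Upper P {x, y})"
proof -
  have "\<phi> s \<subseteq> \<phi> z" if "z \<in> carrier P" "\<phi> x \<subseteq> \<phi> z" "\<phi> y \<subseteq> \<phi> z" for z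
    using J_least[of "\<phi> x" "\<phi> y" "\<phi> z"] that assms by (simp add: in_F)
  moreover have "\<phi> x \<subseteq> \<phi> s" "\<phi> y \<subseteq> \<phi> s" using J[of "\<phi> x" "\<phi> y"] assms by (simp_all add: in_F)
  moreover have "Upper P {x, y} = {u \<in> carrier P. \<phi> x \<subseteq> \<phi> u \<and> \<phi> y \<subseteq> \<phi> u}"
  proof -
    have "Upper P {x, y} = {u \<in> carrier P. le P x u \<and> le P y u}"
      using assms(1,2) by (auto simp: Upper_def)
    then show ?thesis by (simp add: le_P[OF assms(1)] le_P[OF assms(2)] cong: conj_cong)
  qed
  ultimately show ?thesis using assms(3) by (simp add: least_def le_P[OF assms(3)])
qed

lemma greatest_if_M:
  assumes "x \<in> carrier P" "y \<in> carrier P" "s \<in> carrier P" "\<phi> s = M (\<phi> x) (\<phi> y)"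
  shows "greatest P s (Lower P {x, y})"
proof -
  have "\<phi> z \<subseteq> \<phi> s" if "z \<in> carrier P" "\<phi> z \<subseteq> \<phi> x" "\<phi> z \<subseteq> \<phi> y" for z
    using M_greatest[of "\<phi> x" "\<phi> y" "\<phi> z"] that assms by (simp add: in_F)
  moreover have "\<phi> s \<subseteq> \<phi> x" "\<phi> s \<subseteq> \<phi> y" using M[of "\<phi> x" "\<phi> y"] assms by (simp_all add: in_F)
  moreover have "Lower P {x, y} = {u \<in> carrier P. \<phi> u \<subseteq> \<phi> x \<and> \<phi> u \<subseteq> \<phi> y}"
  proof -
    have "Lower P {x, y} = {u \<in> carrier P. le P u x \<and> le P u y}"
      using assms(1,2) by (auto simp: Lower_def)
    then show ?thesis by (simp add: le_P[OF _ assms(1)] le_P[OF _ assms(2)] cong: conj_cong)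
  qed
  ultimately show ?thesis using assms(3) by (simp add: greatest_def le_P[OF _ assms(3)])
qed

lemma lattice: "lattice P"
proof -
  have up: "upper_semilattice P"
  proof (intro upper_semilattice.intro upper_semilattice_axioms.intro partial_order)
    fix x y assume xy: "x \<in> carrier P" "y \<in> carrier P"
    then show "\<exists>s. least P s (Upper P {x, y})"
      using least_if_J ex_preimage J in_F by metis
  qed
  have "lower_semilattice P"
  proof (intro lower_semilattice.intro lower_semilattice_axioms.intro partial_order)
    fix x y assume xy: "x \<in> carrier P" "y \<in> carrier P"
    then show "\<exists>s. greatest P s (Lower P {x, y})"
      using greatest_if_M ex_preimage M in_F by metis
  qed
  then show ?thesis by (intro lattice.intro up)
qed

lemma join:
  assumes "x \<in> carrier P" "y \<in> carrier P"
  shows "x \<squnion>\<^bsub>P\<^esub> y \<in> carrier P \<and> \<phi> (x \<squnion>\<^bsub>P\<^esub> y) = J (\<phi> x) (\<phi> y)"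
proof -
  interpret lattice P by (rule lattice)
  obtain s where s: "s \<in> carrier P" "\<phi> s = J (\<phi> x) (\<phi> y)"
    using assms ex_preimage J in_F by metis
  then have "x \<squnion>\<^bsub>P\<^esub> y = s"
    unfolding join_def sup_def by (intro some_equality least_if_J assms) (blast intro: least_unique least_if_J assms)+
  then show ?thesis using s by simp
qed

lemma meet:
  assumes "x \<in> carrier P" "y \<in> carrier P"
  shows "x \<sqinter>\<^bsub>P\<^esub> y \<in> carrier P \<and> \<phi> (x \<sqinter>\<^bsub>P\<^esub> y) = M (\<phi> x) (\<phi> y)"
proof -
  interpret lattice P by (rule lattice)
  obtain s where s: "s \<in> carrier P" "\<phi> s = M (\<phi> x) (\<phi> y)"
    using assms ex_preimage M in_F by metis
  then have "x \<sqinter>\<^bsub>P\<^esub> y = s"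
    unfolding meet_def inf_def by (intro some_equality greatest_if_M assms) (blast intro: greatest_unique greatest_if_M assms)+
  then show ?thesis using s by simp
qed

lemma finite_lattice: "finite F \<Longrightarrow> F \<noteq> {} \<Longrightarrow> finite_lattice P"
  using lattice bij by (auto simp: finite_lattice_def bij_betw_finite bij_betw_def)

end

text \<open>A map between two such lattices is a homomorphism as soon as it is modelled by a map of sets
  that commutes with the modelled operations, because \<open>\<phi>\<close> is injective on the target.\<close>

lemma lattice_hom_modelI:
  assumes "set_model P \<phi> F J M" "set_model Q \<psi> G K N"
    and f: "\<And>x. x \<in> carrier P \<Longrightarrow> f x \<in> carrier Q \<and> \<psi> (f x) = p (\<phi> x)"
    and J: "\<And>A B. A \<in> F \<Longrightarrow> B \<in> F \<Longrightarrow> p (J A B) = K (p A) (p B)"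
    and M: "\<And>A B. A \<in> F \<Longrightarrow> B \<in> F \<Longrightarrow> p (M A B) = N (p A) (p B)"
  shows "lattice_hom P Q f"
proof -
  interpret P: set_model P \<phi> F J M by fact
  interpret Q: set_model Q \<psi> G K N by fact
  have inj: "u = v" if "u \<in> carrier Q" "v \<in> carrier Q" "\<psi> u = \<psi> v" for u v
    using that Q.bij by (auto simp: bij_betw_def inj_on_def)
  have "f (x \<squnion>\<^bsub>P\<^esub> y) = f x \<squnion>\<^bsub>Q\<^esub> f y \<and> f (x \<sqinter>\<^bsub>P\<^esub> y) = f x \<sqinter>\<^bsub>Q\<^esub> f y"
    if "x \<in> carrier P" "y \<in> carrier P" for x y
    using that P.join[of x y] P.meet[of x y] Q.join[of "f x" "f y"] Q.meet[of "f x" "f y"]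
    by (auto intro!: inj simp: f J M P.in_F)
  then show ?thesis
    using f P.lattice Q.lattice by (auto simp: lattice_hom_def join_pres_def meet_pres_def)
qed


section \<open>Tamari relations\<close>

text \<open>
  In the bracket-vector description of the Tamari lattice a tree is given by the last element \<open>\<beta>(a)\<close>
  of the right subtree of each \<open>a\<close>, or by \<open>a\<close> itself if that subtree is empty.  Here
  \<open>\<beta>(a)\<close> may be infinite, and \<open>D\<close> is the relation
  \<open>a < c \<le> \<beta>(a)\<close>.
\<close>

locale tamari =
  fixes n :: int and D :: "int rel"
  assumes n_ge_2: "n \<ge> 2"
    and less: "\<And>a b. (a, b) \<in> D \<Longrightarrow> a < b"
    and trans: "\<And>a b c. (a, b) \<in> D \<Longrightarrow> (b, c) \<in> D \<Longrightarrow> (a, c) \<in> D"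
    and convex: "\<And>a b c. (a, c) \<in> D \<Longrightarrow> a < b \<Longrightarrow> b < c \<Longrightarrow> (a, b) \<in> D"
    and periodic: "\<And>a b. (a, b) \<in> D \<longleftrightarrow> (a + n, b + n) \<in> D"

text \<open>Translation by \<open>n\<close> generates translation by all its multiples, including the negative ones because
  the hypothesis is an equivalence.\<close>

lemma shift_invariant:
  fixes n m :: int
  assumes "\<And>a b. (a, b) \<in> r \<longleftrightarrow> (a + n, b + n) \<in> r"
  shows "(a + m * n, b + m * n) \<in> r \<longleftrightarrow> (a, b) \<in> r"
proof (induction m rule: int_induct[where k = 0])
  case base
  show ?case by simp
next
  case (step1 i)
  then show ?case using assms[of "a + i * n" "b + i * n"] by (simp add: algebra_simps)
next
  case (step2 i)
  then show ?case using assms[of "a + (i - 1) * n" "b + (i - 1) * n"] by (simp add: algebra_simps)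
qed

lemma representative_above:
  fixes n a b :: int
  assumes "n > 0"
  obtains m where "a \<le> b + m * n" "b + m * n < a + n"
proof
  have "b + (- ((b - a) div n)) * n = a + (b - a) mod n"
    by (simp add: algebra_simps minus_div_mult_eq_mod [symmetric])
  then show "a \<le> b + (- ((b - a) div n)) * n" "b + (- ((b - a) div n)) * n < a + n"
    using assms by simp_all
qed

lemma congruent_shift:
  fixes n a b :: int
  assumes "a mod n = b mod n"
  obtains m where "a = b + m * n"
  using assms by (metis mod_eqE mult.commute)

context tamari
begin

lemma shift: "(a + m * n, b + m * n) \<in> D \<longleftrightarrow> (a, b) \<in> D"
  using shift_invariant[of D n, OF periodic] .

text \<open>An element \<open>a\<close> with \<open>(a, a + n) \<in> D\<close> has an infinite right subtree: periodicity and transitivity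
  give all \<open>(a, a + m * n)\<close>, and convexity fills the gaps.\<close>

lemma long_iff: "(a, a + n) \<in> D \<Longrightarrow> a < c \<Longrightarrow> (a, c) \<in> D"
proof -
  assume l: "(a, a + n) \<in> D" and c: "a < c"
  have mult: "(a, a + (1 + int m) * n) \<in> D" for m
  proof (induction m)
    case 0
    show ?case using l by simp
  next
    case (Suc m)
    have "(a + (1 + int m) * n, a + n + (1 + int m) * n) \<in> D" using shift l by blast
    with trans[OF Suc this] show ?case by (simp add: algebra_simps)
  qed
  have "c - a < (1 + int (nat (c - a))) * n"
  proof -
    have "c - a < (c - a + 1) * 1" by simp
    also have "\<dots> \<le> (c - a + 1) * n" by (rule mult_left_mono) (use c n_ge_2 in auto)
    finally show ?thesis using c by (simp add: algebra_simps)
  qed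
  then have "c < a + (1 + int (nat (c - a))) * n" by linarith
  with convex[OF mult c] show ?thesis by blast
qed

lemma longI: "(a, c) \<in> D \<Longrightarrow> a + n \<le> c \<Longrightarrow> (a, a + n) \<in> D"
  using convex[of a c "a + n"] n_ge_2 by (cases "c = a + n") auto

lemma long_shift: "(a + m * n, a + m * n + n) \<in> D \<longleftrightarrow> (a, a + n) \<in> D"
  using shift[of a m "a + n"] by (simp add: algebra_simps)

lemma long_mod: "a mod n = b mod n \<Longrightarrow> (a, a + n) \<in> D \<longleftrightarrow> (b, b + n) \<in> D"
  using long_shift by (metis congruent_shift)

text \<open>Having an infinite right subtree passes to every node whose right subtree contains such an element.\<close>

lemma long_up: "(a, b) \<in> D \<Longrightarrow> (b, b + n) \<in> D \<Longrightarrow> (a, a + n) \<in> D"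
  using trans[of a b "max (a + n) (b + n)"] long_iff[of b "max (a + n) (b + n)"] longI n_ge_2
  by auto

end

lemma tamari_Int:
  assumes "tamari n D" "tamari n E"
  shows "tamari n (D \<inter> E)"
proof -
  interpret D: tamari n D by fact
  interpret E: tamari n E by fact
  show ?thesis
  proof
    show "(a, b) \<in> D \<inter> E \<longleftrightarrow> (a + n, b + n) \<in> D \<inter> E" for a b
      using D.periodic[of a b] E.periodic[of a b] by blast
  qed (use D.n_ge_2 D.less D.trans E.trans D.convex E.convex in blast)+
qed

lemma tamari_Inter:
  assumes "\<And>D. D \<in> F \<Longrightarrow> tamari n D" "F \<noteq> {}"
  shows "tamari n (\<Inter>F)"
proof -
  obtain E where E: "E \<in> F" using assms(2) by blast
  interpret E: tamari n E using assms(1) E .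
  show ?thesis
  proof
    show "2 \<le> n" by (rule E.n_ge_2)
    show "a < b" if "(a, b) \<in> \<Inter>F" for a b using that E E.less by blast
    show "(a, c) \<in> \<Inter>F" if "(a, b) \<in> \<Inter>F" "(b, c) \<in> \<Inter>F" for a b c
      using that tamari.trans[OF assms(1)] by blast
    show "(a, b) \<in> \<Inter>F" if "(a, c) \<in> \<Inter>F" "a < b" "b < c" for a b c
      using that tamari.convex[OF assms(1)] by blast
    show "(a, b) \<in> \<Inter>F \<longleftrightarrow> (a + n, b + n) \<in> \<Inter>F" for a b
      using tamari.periodic[OF assms(1)] by blast
  qed
qed

lemma tamari_empty: "n \<ge> 2 \<Longrightarrow> tamari n {}"
  by unfold_locales auto

lemma tamari_full: "n \<ge> 2 \<Longrightarrow> tamari n {(a, b). a < b}"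
  by unfold_locales auto

text \<open>Up to translation \<open>0 \<le> a < n\<close>; and a pair \<open>(a, c)\<close> with \<open>c \<ge> a + n\<close> belongs to \<open>D\<close> iff
  \<open>(a, a + n)\<close> does.  So a finite window determines \<open>D\<close>.\<close>

lemma finite_tamari: "finite {D. tamari n D}"
proof -
  let ?W = "{0..<n} \<times> {0..2 * n}"
  have "inj_on (\<lambda>D. D \<inter> ?W) {D. tamari n D}"
  proof (rule inj_onI)
    fix D E assume "D \<in> {D. tamari n D}" "E \<in> {D. tamari n D}" and eq: "D \<inter> ?W = E \<inter> ?W"
    have sub: "A \<subseteq> B" if "tamari n A" "tamari n B" "A \<inter> ?W = B \<inter> ?W" for A B
    proof (rule subrelI)
      interpret A: tamari n A by fact
      interpret B: tamari n B by fact
      fix a b assume ab: "(a, b) \<in> A"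
      obtain m where m: "0 \<le> a + m * n" "a + m * n < 0 + n"
        using representative_above[of n 0 a] A.n_ge_2 by auto
      let ?a = "a + m * n" and ?b = "b + m * n"
      have "(?a, ?b) \<in> B"
      proof (cases "?b < ?a + n")
        case True
        have "(?a, ?b) \<in> A" using ab A.shift by blast
        with A.less[OF this] m True have "(?a, ?b) \<in> A \<inter> ?W" by simp
        then show ?thesis using that(3) by blast
      next
        case False
        then have "(?a, ?a + n) \<in> A" using ab A.shift A.longI by (metis linorder_not_less)
        with m have "(?a, ?a + n) \<in> A \<inter> ?W" by simp
        then show ?thesis using that(3) B.long_iff A.less[OF ab] by auto
      qed
      then show "(a, b) \<in> B" using B.shift by blast
    qed
    show "D = E" using \<open>D \<in> _\<close> \<open>E \<in> _\<close> eq sub[of D E] sub[of E D] by auto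
  qed
  moreover have "(\<lambda>D. D \<inter> ?W) ` {D. tamari n D} \<subseteq> Pow ?W" by blast
  ultimately show ?thesis by (meson finite_Pow_iff finite_SigmaI finite_atLeastAtMost_int
        finite_atLeastLessThan_int inj_on_finite)
qed


section \<open>The projection on Tamari relations\<close>

definition lone_class :: "int \<Rightarrow> int rel \<Rightarrow> int \<Rightarrow> bool" where
  "lone_class n D k \<longleftrightarrow> (k, k + n) \<in> D \<and> (\<forall>a. (a, a + n) \<in> D \<longrightarrow> a mod n = k mod n)"

definition real_rel :: "int \<Rightarrow> int rel \<Rightarrow> bool" where
  "real_rel n D \<longleftrightarrow> \<not> (\<exists>k. lone_class n D k)"

definition proj :: "int \<Rightarrow> int rel \<Rightarrow> int rel" where
  "proj n D = (if real_rel n D then D else D \<inter> {(a, c). c < a + n})"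

text \<open>The closure of \<open>D \<union> E\<close> in the Moore family of Tamari relations.\<close>

definition tam_join :: "int \<Rightarrow> int rel \<Rightarrow> int rel \<Rightarrow> int rel" where
  "tam_join n D E = \<Inter>{C. tamari n C \<and> D \<subseteq> C \<and> E \<subseteq> C}"

lemma proj_subset: "proj n D \<subseteq> D"
  by (simp add: proj_def)

lemma proj_real: "real_rel n D \<Longrightarrow> proj n D = D"
  by (simp add: proj_def)

lemma real_proj: "real_rel n (proj n D)"
  by (auto simp: proj_def real_rel_def lone_class_def)

text \<open>Only transitivity can fail under the truncation, and it would fail on a chain \<open>a < b < a + n \<le> c\<close>.
  Then \<open>a\<close> and \<open>b\<close> both have infinite right subtrees although they are not congruent, against the
  uniqueness of the infinite class.\<close>

lemma tamari_short_part:
  assumes "tamari n D" "lone_class n D k"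
  shows "tamari n (D \<inter> {(a, c). c < a + n})"
proof -
  interpret tamari n D by fact
  show ?thesis
  proof
    fix a b c assume ab: "(a, b) \<in> D \<inter> {(a, c). c < a + n}" and bc: "(b, c) \<in> D \<inter> {(a, c). c < a + n}"
    have "c < a + n"
    proof (rule ccontr)
      assume "\<not> c < a + n"
      then have c: "a + n \<le> c" by simp
      have "(a, a + n) \<in> D" using c ab bc trans longI by blast
      moreover have "(b, a + n) \<in> D" using bc c ab convex[of b c "a + n"] by (cases "c = a + n") auto
      then have "(b, b + n) \<in> D" using trans ab periodic by blast
      ultimately have "a mod n = b mod n" using assms(2) by (metis lone_class_def)
      then have "n dvd b - a" by (metis mod_eq_dvd_iff)
      moreover have "0 < b - a" "b - a < n" using ab less by auto
      ultimately show False by (meson zdvd_not_zless)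
    qed
    then show "(a, c) \<in> D \<inter> {(a, c). c < a + n}" using ab bc trans by blast
  next
    show "(a, b) \<in> D \<inter> {(a, c). c < a + n} \<longleftrightarrow> (a + n, b + n) \<in> D \<inter> {(a, c). c < a + n}" for a b
      using periodic[of a b] by (simp add: add.commute)
    show "2 \<le> n" by (rule n_ge_2)
    show "a < b" if "(a, b) \<in> D \<inter> {(a, c). c < a + n}" for a b using that less[of a b] by auto
    show "(a, b) \<in> D \<inter> {(a, c). c < a + n}" if "(a, c) \<in> D \<inter> {(a, c). c < a + n}" "a < b" "b < c" for a b c
      using that convex[of a c b] by auto
  qed
qed

lemma tamari_proj: "tamari n D \<Longrightarrow> tamari n (proj n D)"
  using tamari_short_part by (auto simp: proj_def real_rel_def)

lemma lone_class_cong: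
  assumes "tamari n D" "lone_class n D k" "(a, a + n) \<in> D"
  shows "lone_class n D a"
  using assms unfolding lone_class_def by metis

text \<open>If \<open>E\<close> is truncated and \<open>D\<close> is not, then \<open>D\<close> has no infinite class at all: one inside \<open>D\<close> would be
  the only one of \<open>E\<close>, hence the only one of \<open>D\<close>.\<close>

lemma proj_mono:
  assumes "tamari n D" "tamari n E" "D \<subseteq> E"
  shows "proj n D \<subseteq> proj n E"
proof (cases "real_rel n D \<and> \<not> real_rel n E")
  case True
  then obtain k where k: "lone_class n E k" by (auto simp: real_rel_def)
  interpret D: tamari n D by fact
  have "(a, a + n) \<notin> D" for a
  proof
    assume a: "(a, a + n) \<in> D"
    then have "lone_class n D a" using k assms(3) unfolding lone_class_def by (metis subsetD)
    then show False using True by (auto simp: real_rel_def)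
  qed
  then have "c < a + n" if "(a, c) \<in> D" for a c using that D.longI by force
  then show ?thesis using assms(3) True by (auto simp: proj_def)
next
  case False
  then show ?thesis using assms(3) by (auto simp: proj_def)
qed

context
  fixes n D E
  assumes D: "tamari n D" and E: "tamari n E"
begin

lemma tamari_join: "tamari n (tam_join n D E)"
proof -
  interpret D: tamari n D by (rule D)
  have "{(a, b). a < b} \<in> {C. tamari n C \<and> D \<subseteq> C \<and> E \<subseteq> C}"
    using tamari_full D.n_ge_2 D.less tamari.less[OF E] by auto
  then show ?thesis unfolding tam_join_def by (intro tamari_Inter) auto
qed

lemma join_upper: "D \<subseteq> tam_join n D E" "E \<subseteq> tam_join n D E"
  by (auto simp: tam_join_def)

lemma join_least: "tamari n C \<Longrightarrow> D \<subseteq> C \<Longrightarrow> E \<subseteq> C \<Longrightarrow> tam_join n D E \<subseteq> C"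
  by (auto simp: tam_join_def)

text \<open>As \<open>proj\<close> is decreasing and monotone, \<open>proj\<close> of the join is still an upper bound of two real relations.\<close>

lemma real_join:
  assumes "real_rel n D" "real_rel n E"
  shows "real_rel n (tam_join n D E)"
proof -
  have "tam_join n D E \<subseteq> proj n (tam_join n D E)"
    using proj_mono[OF D tamari_join] proj_mono[OF E tamari_join] assms
    by (intro join_least tamari_proj tamari_join) (simp_all add: proj_real join_upper)
  then show ?thesis using proj_subset real_proj by (metis subset_antisym)
qed

text \<open>Formal for any monotone, idempotent and decreasing map.\<close>

lemma proj_Int: "proj n (D \<inter> E) = proj n (proj n D \<inter> proj n E)"
proof
  show "proj n (proj n D \<inter> proj n E) \<subseteq> proj n (D \<inter> E)"
    using proj_subset by (intro proj_mono tamari_Int tamari_proj D E) blast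
  have "proj n (D \<inter> E) \<subseteq> proj n D \<inter> proj n E"
    using proj_mono[OF tamari_Int[OF D E] D] proj_mono[OF tamari_Int[OF D E] E] by blast
  then have "proj n (proj n (D \<inter> E)) \<subseteq> proj n (proj n D \<inter> proj n E)"
    by (intro proj_mono tamari_Int tamari_proj D E)
  then show "proj n (D \<inter> E) \<subseteq> proj n (proj n D \<inter> proj n E)"
    by (simp add: proj_real real_proj)
qed

lemma real_meet: "tamari n (proj n (D \<inter> E))" "real_rel n (proj n (D \<inter> E))" "proj n (D \<inter> E) \<subseteq> D"
    "proj n (D \<inter> E) \<subseteq> E" "tamari n C \<Longrightarrow> real_rel n C \<Longrightarrow> C \<subseteq> D \<Longrightarrow> C \<subseteq> E \<Longrightarrow> C \<subseteq> proj n (D \<inter> E)"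
proof -
  have DE: "tamari n (D \<inter> E)" by (rule tamari_Int[OF D E])
  show "tamari n (proj n (D \<inter> E))" by (rule tamari_proj[OF DE])
  show "real_rel n (proj n (D \<inter> E))" by (rule real_proj)
  show "proj n (D \<inter> E) \<subseteq> D" "proj n (D \<inter> E) \<subseteq> E" using proj_subset by blast+
  show "C \<subseteq> proj n (D \<inter> E)" if "tamari n C" "real_rel n C" "C \<subseteq> D" "C \<subseteq> E"
    using proj_mono[OF that(1) DE] that by (simp add: proj_real)
qed

end

text \<open>Enlarging the right subtrees of the class of \<open>k\<close> would break transitivity only at some \<open>(a, b)\<close> with
  \<open>b\<close> in that class and \<open>a\<close> not.  But \<open>b\<close> already reaches up to \<open>b + n - 1\<close>, so \<open>a\<close> would reach a point
  \<open>\<ge> a + n\<close> in \<open>u\<close>, which \<open>short\<close> forbids.\<close>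

lemma tamari_add_class:
  assumes "tamari n u" and short: "\<And>a c. (a, c) \<in> u \<Longrightarrow> c < a + n"
    and k: "\<And>c. k < c \<Longrightarrow> c < k + n \<Longrightarrow> (k, c) \<in> u"
  shows "tamari n (u \<union> {(a, c). a mod n = k mod n \<and> a < c})"
proof -
  interpret tamari n u by fact
  let ?v = "u \<union> {(a, c). a mod n = k mod n \<and> a < c}"
  show ?thesis
  proof
    fix a b c assume ab: "(a, b) \<in> ?v" and bc: "(b, c) \<in> ?v"
    show "(a, c) \<in> ?v"
    proof (cases "a mod n = k mod n")
      case True
      moreover have "a < b" "b < c" using ab bc less by auto
      ultimately show ?thesis by simp
    next
      case False
      then have ab': "(a, b) \<in> u" using ab by auto
      have "b mod n \<noteq> k mod n"
      proof
        assume "b mod n = k mod n"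
        then obtain m where m: "b = k + m * n" by (rule congruent_shift)
        have "(k, k + n - 1) \<in> u" using k n_ge_2 by auto
        then have "(k + m * n, k + n - 1 + m * n) \<in> u" using shift by blast
        then have "(b, b + n - 1) \<in> u" using m by (simp add: algebra_simps)
        with ab' trans short have "b + n - 1 < a + n" by blast
        with less[OF ab'] show False by simp
      qed
      then show ?thesis using ab' bc trans by auto
    qed
  next
    show "(a, b) \<in> ?v \<longleftrightarrow> (a + n, b + n) \<in> ?v" for a b
      using periodic[of a b] by simp
    show "2 \<le> n" by (rule n_ge_2)
    show "a < b" if "(a, b) \<in> ?v" for a b using that less[of a b] by auto
    show "(a, b) \<in> ?v" if "(a, c) \<in> ?v" "a < b" "b < c" for a b c
      using that convex[of a c b] by auto
  qed
qed

text \<open>The class of \<open>k\<close> is the one that is infinite in \<open>D\<close> but not in \<open>u\<close>.  In \<open>u\<close> it reaches as far as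
  a finite class can, and any other class reaching equally far would make it infinite in \<open>u\<close>.
  Therefore \<open>u\<close> has only finite right subtrees, and \<open>D\<close> and \<open>E\<close> can have no infinite class except that
  of \<open>k\<close>.\<close>

lemma proj_le_join_proj:
  assumes D: "tamari n D" and E: "tamari n E" and u: "u = tam_join n (proj n D) (proj n E)"
    and "\<not> D \<subseteq> u"
  shows "proj n (tam_join n D E) \<subseteq> u"
proof -
  interpret D: tamari n D by fact
  interpret E: tamari n E by fact
  interpret u: tamari n u using u tamari_join[OF tamari_proj[OF D] tamari_proj[OF E]] by simp
  have upper: "proj n D \<subseteq> u" "proj n E \<subseteq> u"
    using join_upper[OF tamari_proj[OF D] tamari_proj[OF E]] u by auto
  obtain k c where kc: "(k, c) \<in> D" "(k, c) \<notin> u" using \<open>\<not> D \<subseteq> u\<close> by auto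
  then have nr: "\<not> real_rel n D" using upper proj_real by auto
  have "\<not> c < k + n" using kc upper nr by (auto simp: proj_def)
  then have kD: "(k, k + n) \<in> D" using kc D.longI by simp
  then have lone: "lone_class n D k" using nr lone_class_cong[OF D] by (auto simp: real_rel_def)
  have near: "(k, b) \<in> u" if "k < b" "b < k + n" for b
    using upper(1) nr that D.long_iff[OF kD] by (auto simp: proj_def)
  have k_u: "(k, k + n) \<notin> u" using u.long_iff kc D.less by blast
  \<comment> \<open>A class reaching at least as far as that of \<open>k\<close> is that of \<open>k\<close>; \<open>a + m * n\<close> is its member in \<open>[k, k + n)\<close>.\<close>
  have short_class: "a mod n = k mod n" if "\<And>b. a + m * n < b \<Longrightarrow> b < a + m * n + n \<Longrightarrow> (a + m * n, b) \<in> u"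
      "k \<le> a + m * n" "a + m * n < k + n" for a m
  proof (rule ccontr)
    assume "a mod n \<noteq> k mod n"
    then have "a + m * n \<noteq> k" by (metis mod_mult_self1)
    then have "(k, a + m * n) \<in> u" "(a + m * n, k + n) \<in> u" using that near by auto
    then show False using u.trans k_u by blast
  qed
  have short: "c < a + n" if ac: "(a, c) \<in> u" for a c
  proof (rule ccontr)
    assume "\<not> c < a + n"
    then have a: "(a, a + n) \<in> u" using ac u.longI by simp
    obtain m where m: "k \<le> a + m * n" "a + m * n < k + n"
      using representative_above D.n_ge_2 by (metis less_le_trans zero_less_numeral)
    have "a mod n = k mod n"
      by (rule short_class[OF _ m]) (use a u.long_shift u.long_iff in blast)
    then show False using a k_u u.long_mod by blast
  qed
  let ?v = "u \<union> {(a, c). a mod n = k mod n \<and> a < c}"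
  have v: "tamari n ?v" using tamari_add_class[OF u.tamari_axioms short near] by blast
  have "A \<subseteq> ?v" if A: "tamari n A" "proj n A \<subseteq> u" for A
  proof (rule subrelI)
    interpret A: tamari n A by fact
    fix a c assume ac: "(a, c) \<in> A"
    show "(a, c) \<in> ?v"
    proof (cases "(a, c) \<in> proj n A")
      case True
      then show ?thesis using A(2) by blast
    next
      case False
      then have nr: "\<not> real_rel n A" and "\<not> c < a + n" using ac by (auto simp: proj_def split: if_splits)
      then have aA: "(a, a + n) \<in> A" using ac A.longI by simp
      obtain m where m: "k \<le> a + m * n" "a + m * n < k + n"
        using representative_above D.n_ge_2 by (metis less_le_trans zero_less_numeral)
      have "a mod n = k mod n"
      proof (rule short_class[OF _ m])
        fix b assume b: "a + m * n < b" "b < a + m * n + n"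
        have "(a + m * n, b) \<in> A" using aA A.long_shift A.long_iff b by blast
        then show "(a + m * n, b) \<in> u" using A(2) nr b by (auto simp: proj_def)
      qed
      then show ?thesis using A.less[OF ac] by simp
    qed
  qed
  then have "tam_join n D E \<subseteq> ?v" using join_least[OF D E v] upper D E by blast
  then have "proj n (tam_join n D E) \<subseteq> proj n ?v" by (intro proj_mono tamari_join D E v)
  moreover have "lone_class n ?v k"
    using short D.n_ge_2 by (fastforce simp: lone_class_def)
  then have "proj n ?v = ?v \<inter> {(a, c). c < a + n}" by (auto simp: proj_def real_rel_def)
  moreover have "(a, c) \<in> u" if "a mod n = k mod n" "a < c" "c < a + n" for a c
  proof -
    obtain m where m: "a = k + m * n" using \<open>a mod n = k mod n\<close> by (rule congruent_shift)
    then have "(k, c - m * n) \<in> u" using near that by auto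
    then show ?thesis using u.shift[of k m "c - m * n"] m by simp
  qed
  ultimately show ?thesis by auto
qed

lemma tam_join_commute: "tam_join n D E = tam_join n E D"
  by (auto simp: tam_join_def)

lemma proj_join:
  assumes D: "tamari n D" and E: "tamari n E"
  shows "proj n (tam_join n D E) = tam_join n (proj n D) (proj n E)"
proof
  note DE = tamari_proj[OF D] tamari_proj[OF E]
  let ?u = "tam_join n (proj n D) (proj n E)"
  show "proj n (tam_join n D E) \<subseteq> ?u"
  proof (cases "D \<subseteq> ?u \<and> E \<subseteq> ?u")
    case True
    then have "tam_join n D E \<subseteq> ?u" using join_least[OF D E tamari_join[OF DE]] by blast
    then show ?thesis using proj_subset by blast
  next
    case False
    then show ?thesis
      using proj_le_join_proj[OF D E refl] proj_le_join_proj[OF E D refl] tam_join_commute by metis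
  qed
  show "?u \<subseteq> proj n (tam_join n D E)"
    using proj_mono[OF D tamari_join[OF D E]] proj_mono[OF E tamari_join[OF D E]]
      join_upper[OF D E] join_least[OF DE tamari_proj[OF tamari_join[OF D E]]] by blast
qed


section \<open>Total orders and their inversions\<close>

definition inversions :: "int rel \<Rightarrow> int rel" where
  "inversions r = {(a, b). a < b \<and> (b, a) \<in> r}"

text \<open>The total order that inverts exactly the pairs in \<open>D\<close>.\<close>

definition ord_of :: "int rel \<Rightarrow> int rel" where
  "ord_of D = {(x, y). x = y \<or> x < y \<and> (x, y) \<notin> D \<or> (y, x) \<in> D}"

lemma linear_orderD:
  assumes "linear_order r"
  shows "(x, x) \<in> r" "(x, y) \<in> r \<Longrightarrow> (y, z) \<in> r \<Longrightarrow> (x, z) \<in> r"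
    "(x, y) \<in> r \<Longrightarrow> (y, x) \<in> r \<Longrightarrow> x = y" "(x, y) \<in> r \<or> (y, x) \<in> r"
proof -
  have r: "refl r" "trans r" "antisym r" "total r"
    using assms by (simp_all add: linear_order_on_def partial_order_on_def preorder_on_def)
  show "(x, x) \<in> r" using r(1) by (simp add: refl_onD)
  show "(x, y) \<in> r \<Longrightarrow> (y, z) \<in> r \<Longrightarrow> (x, z) \<in> r" using r(2) by (rule transD)
  show "(x, y) \<in> r \<Longrightarrow> (y, x) \<in> r \<Longrightarrow> x = y" using r(3) by (rule antisymD)
  show "(x, y) \<in> r \<or> (y, x) \<in> r" using r(1,4) by (cases "x = y") (auto simp: refl_onD total_on_def)
qed

lemma ord_of_inversions:
  assumes "linear_order r"
  shows "ord_of (inversions r) = r"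
proof -
  have "(x, y) \<in> ord_of (inversions r) \<longleftrightarrow> (x, y) \<in> r" for x y
    using linear_orderD(1)[OF assms, of x] linear_orderD(3)[OF assms, of x y] linear_orderD(4)[OF assms, of x y]
    by (cases x y rule: linorder_cases) (auto simp: ord_of_def inversions_def)
  then show ?thesis by auto
qed

lemma inversions_ord_of: "(\<And>a b. (a, b) \<in> D \<Longrightarrow> a < b) \<Longrightarrow> inversions (ord_of D) = D"
  by (fastforce simp: ord_of_def inversions_def)

lemma dyer_le_iff:
  assumes r: "tito n r" and s: "tito n s"
  shows "dyer_le n r s \<longleftrightarrow> inversions r \<subseteq> inversions s"
proof
  assume "inversions r \<subseteq> inversions s"
  then show "dyer_le n r s" unfolding dyer_le_def Inv_def inversions_def by blast
next
  assume le: "dyer_le n r s"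
  show "inversions r \<subseteq> inversions s"
  proof (rule subrelI)
    fix a b assume ab: "(a, b) \<in> inversions r"
    then have "reflection_index n (a, b) \<in> Inv n r" by (auto simp: Inv_def inversions_def)
    then obtain c d where cd: "c < d" "(d, c) \<in> s" "reflection_index n (a, b) = reflection_index n (c, d)"
      using le unfolding dyer_le_def Inv_def by (smt (verit) case_prodE image_iff mem_Collect_eq subsetD)
    have "(a, b) \<in> reflection_index n (a, b)" by (auto simp: reflection_index_def intro!: exI[of _ 0])
    then have "(a, b) \<in> reflection_index n (c, d)" using cd(3) by simp
    then obtain m where "a = c + m * n" "b = d + m * n" by (auto simp: reflection_index_def)
    moreover have "(d + m * n, c + m * n) \<in> s"
      using cd(2) s by (subst shift_invariant) (auto simp: tito_def)
    ultimately show "(a, b) \<in> inversions s" using cd(1) by (simp add: inversions_def)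
  qed
qed

text \<open>Convexity is what avoiding 312 says about inversions: if \<open>a < b < c\<close> and \<open>c\<close> precedes \<open>a\<close>, then \<open>a\<close>
  must not precede \<open>b\<close>.\<close>

lemma tamari_inversions:
  assumes n: "n \<ge> 2" and r: "tito n r" and "avoids_312 r"
  shows "tamari n (inversions r)"
proof -
  have lin: "linear_order r" using r by (simp add: tito_def)
  note lin = linear_orderD[OF lin]
  show ?thesis
  proof
    show "2 \<le> n" by (rule n)
    show "a < b" if "(a, b) \<in> inversions r" for a b using that by (simp add: inversions_def)
    show "(a, c) \<in> inversions r" if "(a, b) \<in> inversions r" "(b, c) \<in> inversions r" for a b c
      using that lin(2)[of c b a] by (auto simp: inversions_def)
    show "(a, b) \<in> inversions r" if "(a, c) \<in> inversions r" "a < b" "b < c" for a b c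
      using that assms(3) lin(4)[of a b] by (auto simp: inversions_def avoids_312_def)
    have "(b, a) \<in> r \<longleftrightarrow> (b + n, a + n) \<in> r" for a b using r unfolding tito_def by blast
    then show "(a, b) \<in> inversions r \<longleftrightarrow> (a + n, b + n) \<in> inversions r" for a b
      by (simp add: inversions_def)
  qed
qed

context tamari
begin

lemma ord_of_up: "x < y \<Longrightarrow> (x, y) \<in> ord_of D \<longleftrightarrow> (x, y) \<notin> D"
  using less[of y x] by (auto simp: ord_of_def)

lemma ord_of_down: "y < x \<Longrightarrow> (x, y) \<in> ord_of D \<longleftrightarrow> (y, x) \<in> D"
  by (auto simp: ord_of_def)

lemma linear_ord_of: "linear_order (ord_of D)"
proof -
  have "(x, z) \<in> ord_of D" if xy: "(x, y) \<in> ord_of D" and yz: "(y, z) \<in> ord_of D" for x y z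
  proof (cases "x = y \<or> y = z \<or> x = z")
    case True
    then show ?thesis using that by (auto simp: ord_of_def)
  next
    case False
    then consider "x < y" "y < z" | "x < z" "z < y" | "y < x" "x < z" | "y < z" "z < x" | "z < x" "x < y" | "z < y" "y < x"
      by linarith
    then show ?thesis
    proof cases
      case 1
      then show ?thesis using xy yz convex[of x z y] by (auto simp: ord_of_up)
    next
      case 2
      then show ?thesis using xy yz trans[of x z y] by (auto simp: ord_of_up ord_of_down)
    next
      case 3
      then show ?thesis using xy yz trans[of y x z] by (auto simp: ord_of_up ord_of_down)
    next
      case 4
      then show ?thesis using xy yz convex[of y x z] by (auto simp: ord_of_up ord_of_down)
    next
      case 5
      then show ?thesis using xy yz convex[of z y x] by (auto simp: ord_of_up ord_of_down)
    next
      case 6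
      then show ?thesis using xy yz trans[of z y x] by (auto simp: ord_of_down)
    qed
  qed
  then have "trans (ord_of D)" by (rule transI)
  moreover have "antisym (ord_of D)"
  proof (rule antisymI)
    fix x y assume "(x, y) \<in> ord_of D" "(y, x) \<in> ord_of D"
    then show "x = y" by (cases x y rule: linorder_cases) (simp_all add: ord_of_up ord_of_down)
  qed
  ultimately show ?thesis
    by (force simp: linear_order_on_def partial_order_on_def preorder_on_def refl_on_def total_on_def ord_of_def)
qed

lemma inversions_ord_of: "inversions (ord_of D) = D"
  using less by (rule inversions_ord_of)

lemma tito_ord_of: "tito n (ord_of D)"
proof -
  have "(a, b) \<in> ord_of D \<longleftrightarrow> (a + n, b + n) \<in> ord_of D" for a b
    using periodic[of a b] periodic[of b a] by (simp add: ord_of_def)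
  then show ?thesis using linear_ord_of by (simp add: tito_def)
qed

lemma avoids_312_ord_of: "avoids_312 (ord_of D)"
proof -
  have "(a, b) \<notin> ord_of D" if "a < b" "b < c" "(c, a) \<in> ord_of D" for a b c
    using that convex[of a c b] less[of b a] by (auto simp: ord_of_def)
  then show ?thesis by (auto simp: avoids_312_def)
qed

text \<open>If the class of \<open>k\<close> is the only infinite one, it is a block, decreasing and of size 1: an element
  between two of its members would have an infinite right subtree itself, and so belong to the class.  Conversely, let a block of
  size 1 contain \<open>a\<close> with \<open>a + n\<close> before \<open>a\<close>.  A second infinite class has a member \<open>b\<close> with
  \<open>a < b < a + n\<close>, and \<open>b\<close> lies between \<open>a\<close> and every \<open>a + j * n\<close> with \<open>j > 0\<close>, hence in the block.\<close>

lemma real_tito_ord_of: "real_tito n (ord_of D) \<longleftrightarrow> real_rel n D"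
proof
  let ?r = "ord_of D"
  assume real: "real_tito n ?r"
  show "real_rel n D"
    unfolding real_rel_def
  proof
    assume "\<exists>k. lone_class n D k"
    then obtain k where k: "lone_class n D k" by blast
    let ?I = "{a. a mod n = k mod n}"
    have long: "(a, b) \<in> D" if "a mod n = k mod n" "a < b" for a b
      using that k long_mod long_iff unfolding lone_class_def by metis
    have lone: "a mod n = k mod n" if "(a, a + n) \<in> D" for a
      using that k unfolding lone_class_def by blast
    have between: "x mod n = k mod n \<and> b \<le> x \<and> x \<le> a"
      if ab: "a mod n = k mod n" "b mod n = k mod n" and x: "(a, x) \<in> ?r" "(x, b) \<in> ?r" for a b x
    proof -
      have "\<not> a < x" using x(1) long[OF ab(1), of x] less[of x a] by (auto simp: ord_of_def)
      moreover have "\<not> x < b"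
      proof
        assume "x < b"
        then have "(x, b) \<notin> D" using x(2) less[of x b] less[of b x] by (auto simp: ord_of_def)
        have "a \<noteq> x" using ab(1) long[of x b] \<open>x < b\<close> \<open>(x, b) \<notin> D\<close> by auto
        with x(1) \<open>\<not> a < x\<close> have "(x, a) \<in> D" using less[of x a] by (auto simp: ord_of_def)
        then have "(x, x + n) \<in> D" using long_up long[OF ab(1)] n_ge_2 by simp
        then show False using long_iff \<open>x < b\<close> \<open>(x, b) \<notin> D\<close> by blast
      qed
      moreover have "x mod n = k mod n"
      proof (cases "x = a")
        case False
        with x(1) \<open>\<not> a < x\<close> have "(x, a) \<in> D" using less[of x a] by (auto simp: ord_of_def)
        then have "(x, x + n) \<in> D" using long_up long[OF ab(1)] n_ge_2 by simp
        then show ?thesis by (rule lone)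
      qed (simp add: ab)
      ultimately show ?thesis by auto
    qed
    have "block ?r ?I"
      unfolding block_def
    proof (intro conjI ballI)
      show "?I \<noteq> {}" by blast
      show "order_interval ?r a b \<subseteq> ?I" if "a \<in> ?I" "b \<in> ?I" for a b
        unfolding order_interval_def using that between[of a b] by blast
      show "finite (order_interval ?r a b)" if "a \<in> ?I" "b \<in> ?I" for a b
      proof (rule finite_subset)
        show "order_interval ?r a b \<subseteq> {b..a}"
        proof
          fix x assume "x \<in> order_interval ?r a b"
          then have "b \<le> x \<and> x \<le> a" using that between[of a b x] unfolding order_interval_def by blast
          then show "x \<in> {b..a}" by simp
        qed
      qed simp
      have "(a + n, a) \<in> ?r" if "a mod n = k mod n" for a
        using long[OF that, of "a + n"] n_ge_2 by (simp add: ord_of_def)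
      then have down: "(a + n, a) \<in> ?r \<and> (a, a - n) \<in> ?r" if "a mod n = k mod n" for a
        using that by (metis diff_add_cancel minus_mod_self2)
      have residue: "a + n \<in> ?I \<and> a - n \<in> ?I" if "a \<in> ?I" for a
        using that by (metis mem_Collect_eq minus_mod_self2 mod_add_self2)
      have ne: "a + n \<noteq> a" "a - n \<noteq> a" for a using n_ge_2 by auto
      show "\<not> (\<exists>m\<in>?I. \<forall>x\<in>?I. (x, m) \<in> ?r \<longrightarrow> x = m)" using down residue ne by blast
      show "\<not> (\<exists>m\<in>?I. \<forall>x\<in>?I. (m, x) \<in> ?r \<longrightarrow> x = m)" using down residue ne by blast
    qed
    moreover have "(\<lambda>a. a mod n) ` ?I = {k mod n}" by auto
    then have "block_size n ?I = 1" by (simp add: block_size_def)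
    ultimately have "(k, k + n) \<in> ?r" using real by (auto simp: real_tito_def waxing_def)
    then show False using long[OF refl, of "k + n"] less n_ge_2 by (fastforce simp: ord_of_def)
  qed
next
  let ?r = "ord_of D"
  assume real: "real_rel n D"
  show "real_tito n ?r"
    unfolding real_tito_def waxing_def
  proof (intro allI impI ballI, rule ccontr)
    fix I a assume I: "block ?r I \<and> block_size n I = 1" and a: "a \<in> I" "(a, a + n) \<notin> ?r"
    obtain c where c: "(\<lambda>a. a mod n) ` I = {c}"
      using I by (auto simp: block_size_def card_1_singleton_iff)
    have residue: "x mod n = a mod n" if "x \<in> I" for x using c that a(1) by (metis imageI singletonD)
    have long: "(a, a + n) \<in> D" using a(2) n_ge_2 by (simp add: ord_of_def)
    obtain b where b: "(b, b + n) \<in> D" "b mod n \<noteq> a mod n"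
      using real long unfolding real_rel_def lone_class_def by blast
    obtain m where m: "a \<le> b + m * n" "b + m * n < a + n"
      using representative_above n_ge_2 by (metis less_le_trans zero_less_numeral)
    let ?b = "b + m * n"
    have b': "?b mod n \<noteq> a mod n" "(?b, ?b + n) \<in> D" using b long_shift by auto
    then have ab: "(a, ?b) \<in> D" using long_iff[OF long, of ?b] m by (cases "a = ?b") auto
    obtain x where x: "x \<in> I" "(x, a) \<in> ?r" "x \<noteq> a"
      using I a(1) unfolding block_def by blast
    have "(a, x) \<in> D"
      using x(2,3) long long_mod[OF residue[OF x(1)]] long_iff[of x a] by (auto simp: ord_of_def)
    then have "a < x" by (rule less)
    moreover obtain j where j: "x = a + j * n" using residue[OF x(1)] by (rule congruent_shift)
    ultimately have "j > 0" using n_ge_2 by (simp add: zero_less_mult_iff)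
    then have "n \<le> j * n" using mult_right_mono[of 1 j n] n_ge_2 by simp
    then have "?b < x" using j m by linarith
    then have "(?b, x) \<in> D" by (rule long_iff[OF b'(2)])
    then have "?b \<in> order_interval ?r x a" using ab by (simp add: order_interval_def ord_of_def)
    then have "?b \<in> I" using I x(1) a(1) unfolding block_def by blast
    with residue b' show False by blast
  qed
qed

end


section \<open>The tree of a Tamari relation\<close>

text \<open>The left subtree that \<open>a\<close> must have: \<open>y\<close> belongs to it iff all integers from \<open>y\<close> up to \<open>a\<close>
  precede \<open>a\<close> in \<open>ord_of D\<close>.\<close>

definition left_set :: "int rel \<Rightarrow> int \<Rightarrow> int set" where
  "left_set D a = {y. y < a \<and> (\<forall>z. y \<le> z \<and> z < a \<longrightarrow> (z, a) \<notin> D)}"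

definition right_set :: "int rel \<Rightarrow> int \<Rightarrow> int set" where
  "right_set D a = {y. (a, y) \<in> D}"

text \<open>The root of a subtree is its last element in post-order.\<close>

definition root_of :: "int rel \<Rightarrow> int set \<Rightarrow> int option" where
  "root_of D A = (if A = {} then None else Some (THE w. w \<in> A \<and> (\<forall>z\<in>A. (z, w) \<in> ord_of D)))"

definition tree_of :: "int rel \<Rightarrow> int bintree" where
  "tree_of D = \<lparr>lchild = (\<lambda>a. root_of D (left_set D a)), rchild = (\<lambda>a. root_of D (right_set D a))\<rparr>"

lemma finite_linear_order_max:
  assumes "linear_order r" "finite A" "A \<noteq> {}"
  shows "\<exists>w\<in>A. \<forall>z\<in>A. (z, w) \<in> r"
  using assms(2,3)
proof (induction rule: finite_ne_induct)
  case (singleton x)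
  then show ?case using linear_orderD(1)[OF assms(1)] by simp
next
  case (insert x F)
  then obtain w where w: "w \<in> F" "\<forall>z\<in>F. (z, w) \<in> r" by blast
  note lin = linear_orderD[OF assms(1)]
  consider "(x, w) \<in> r" | "(w, x) \<in> r" using lin(4) by blast
  then show ?case
  proof cases
    case 1
    then show ?thesis using w by auto
  next
    case 2
    then have "\<forall>z\<in>insert x F. (z, x) \<in> r" using w lin(1,2) by blast
    then show ?thesis by blast
  qed
qed

context tamari
begin

abbreviation r where "r \<equiv> ord_of D"

lemmas lin = linear_orderD[OF linear_ord_of]

definition subtree :: "int \<Rightarrow> int set" where
  "subtree a = {y. \<forall>z. min a y \<le> z \<and> z \<le> max a y \<longrightarrow> (z, a) \<in> r}"

text \<open>The set \<open>subtree a\<close> is to be the set of descendants of \<open>a\<close>.  Its definition through \<open>r\<close> is symmetric in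
  left and right, which makes the ancestor relation easy to handle; convexity of \<open>D\<close> gives the
  comparison with the one-sided sets.\<close>

lemma subtree_eq: "subtree a = insert a (left_set D a \<union> right_set D a)"
proof -
  have "y \<in> subtree a \<longleftrightarrow> y = a \<or> y \<in> left_set D a \<or> y \<in> right_set D a" for y
  proof (cases y a rule: linorder_cases)
    case less
    have "(z, a) \<in> r \<longleftrightarrow> z < a \<longrightarrow> (z, a) \<notin> D" if "z \<le> a" for z
      using that tamari.less[OF tamari_axioms, of a z] by (auto simp: ord_of_def)
    then show ?thesis
      using less tamari.less[OF tamari_axioms, of a y] by (auto simp: subtree_def left_set_def right_set_def)
  next
    case equal
    then have "\<forall>z. min a y \<le> z \<and> z \<le> max a y \<longrightarrow> (z, a) \<in> r"
      using lin(1)[of a] by (metis max.idem min.idem order.antisym)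
    then have "y \<in> subtree a" unfolding subtree_def by blast
    then show ?thesis using equal by simp
  next
    case greater
    have "(z, a) \<in> r \<longleftrightarrow> a < z \<longrightarrow> (a, z) \<in> D" if "a \<le> z" for z
      using that tamari.less[OF tamari_axioms, of z a] by (auto simp: ord_of_def)
    moreover have "\<forall>z. a \<le> z \<and> z \<le> y \<longrightarrow> (a < z \<longrightarrow> (a, z) \<in> D)" if "(a, y) \<in> D"
      using that convex[OF that] by (metis antisym_conv2)
    ultimately show ?thesis
      using greater by (auto simp: subtree_def left_set_def right_set_def)
  qed
  then show ?thesis by auto
qed

lemma left_set_eq: "left_set D a = subtree a \<inter> {..<a}"
  and right_set_eq: "right_set D a = subtree a \<inter> {a<..}"
proof -
  show "left_set D a = subtree a \<inter> {..<a}" using less[of a] by (force simp: subtree_eq left_set_def right_set_def)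
  have "y \<notin> left_set D a \<or> y < a" "y \<notin> right_set D a \<or> a < y" for y
    using less[of a y] by (auto simp: left_set_def right_set_def)
  then show "right_set D a = subtree a \<inter> {a<..}" unfolding subtree_eq by force
qed

lemma subtree_up: "a < y \<Longrightarrow> y \<in> subtree a \<longleftrightarrow> (a, y) \<in> D"
  by (simp add: subtree_eq left_set_def right_set_def)

lemma subtree_down: "y < a \<Longrightarrow> y \<in> subtree a \<longleftrightarrow> (\<forall>z. y \<le> z \<and> z < a \<longrightarrow> (z, a) \<notin> D)"
  using less[of a y] by (auto simp: subtree_eq left_set_def right_set_def)

lemma subD: "y \<in> subtree a \<Longrightarrow> min a y \<le> z \<Longrightarrow> z \<le> max a y \<Longrightarrow> (z, a) \<in> r"
  by (simp add: subtree_def)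

lemma subtree_self: "a \<in> subtree a"
  by (simp add: subtree_eq)

lemma subtree_trans:
  assumes "y \<in> subtree b" "b \<in> subtree a"
  shows "y \<in> subtree a"
  unfolding subtree_def
proof (clarify)
  fix z assume "min a y \<le> z" "z \<le> max a y"
  then have "min a b \<le> z \<and> z \<le> max a b \<or> min b y \<le> z \<and> z \<le> max b y" by linarith
  then show "(z, a) \<in> r" using subD[OF assms(2)] subD[OF assms(1)] lin(2)[of z b a] by (meson max.cobounded2 min.cobounded2)
qed

text \<open>Of two ancestors of \<open>y\<close>, the later one in \<open>r\<close> dominates the whole range between them, as this is
  covered by the two ranges reaching to \<open>y\<close>.\<close>

lemma subtree_chain:
  assumes "y \<in> subtree a" "y \<in> subtree b"
  shows "a \<in> subtree b \<or> b \<in> subtree a"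
proof -
  have *: "a \<in> subtree b" if "(a, b) \<in> r" "y \<in> subtree a" "y \<in> subtree b" for a b
    unfolding subtree_def
  proof (clarify)
    fix z assume "min b a \<le> z" "z \<le> max b a"
    then have "min a y \<le> z \<and> z \<le> max a y \<or> min b y \<le> z \<and> z \<le> max b y" by linarith
    then show "(z, b) \<in> r" using subD[OF that(2)] subD[OF that(3)] lin(2)[OF _ that(1)] by blast
  qed
  show ?thesis using *[of a b] *[of b a] assms lin(4)[of a b] by blast
qed

lemma same_side:
  assumes "w \<in> subtree u" "u \<in> subtree v"
  shows "u \<in> left_set D v \<Longrightarrow> w \<in> left_set D v" "u \<in> right_set D v \<Longrightarrow> w \<in> right_set D v"
proof -
  have w: "w \<in> subtree v" using subtree_trans assms by blast
  have no: False if "u \<noteq> v" "min u w \<le> v" "v \<le> max u w"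
    using subD[OF assms(1) that(2,3)] subD[OF assms(2), of u] lin(3)[of u v] that(1) by simp
  show "u \<in> left_set D v \<Longrightarrow> w \<in> left_set D v" "u \<in> right_set D v \<Longrightarrow> w \<in> right_set D v"
    using no w by (force simp: left_set_eq right_set_eq)+
qed

text \<open>\<open>left_set D a\<close> may be infinite, but its members below \<open>a - n\<close> precede \<open>a - 1\<close>, so a largest one exists
  among the last \<open>n\<close>.\<close>

lemma max_in_left:
  assumes "left_set D a \<noteq> {}"
  shows "\<exists>w\<in>left_set D a. \<forall>z\<in>left_set D a. (z, w) \<in> r"
proof -
  obtain y where y: "y \<in> left_set D a" using assms by blast
  then have a1: "a - 1 \<in> left_set D a" by (auto simp: left_set_def)
  let ?A = "left_set D a \<inter> {a - n..<a}"
  have "?A \<noteq> {}" using a1 n_ge_2 by auto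
  then obtain w where w: "w \<in> ?A" "\<forall>z\<in>?A. (z, w) \<in> r"
    using finite_linear_order_max[OF linear_ord_of, of ?A] finite_Int finite_atLeastLessThan_int by blast
  have "(z, w) \<in> r" if z: "z \<in> left_set D a" for z
  proof (cases "z \<in> ?A")
    case False
    then have "z + n \<le> a - 1" using z by (auto simp: left_set_def)
    have "(z, a) \<notin> D" "z < a" using z by (auto simp: left_set_def)
    then have "(z, a - 1) \<notin> D" using longI[of z "a - 1"] long_iff[of z a] \<open>z + n \<le> a - 1\<close> by blast
    then have "(z, a - 1) \<in> r" using \<open>z + n \<le> a - 1\<close> n_ge_2 by (simp add: ord_of_def)
    moreover have "(a - 1, w) \<in> r" using w(2) a1 n_ge_2 by simp
    ultimately show ?thesis by (rule lin(2))
  qed (use w in blast)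
  then show ?thesis using w by blast
qed

text \<open>If \<open>right_set D a\<close> is infinite it contains \<open>a + n\<close>, which dominates all that follows.\<close>

lemma max_in_right:
  assumes "right_set D a \<noteq> {}"
  shows "\<exists>w\<in>right_set D a. \<forall>z\<in>right_set D a. (z, w) \<in> r"
proof -
  obtain y where y: "(a, y) \<in> D" using assms by (auto simp: right_set_def)
  let ?A = "right_set D a \<inter> {a<..a + n}"
  have "(a, a + 1) \<in> D" using y convex[OF y, of "a + 1"] less[OF y] by (cases "y = a + 1") auto
  then have "?A \<noteq> {}" using n_ge_2 by (auto simp: right_set_def)
  then obtain w where w: "w \<in> ?A" "\<forall>z\<in>?A. (z, w) \<in> r"
    using finite_linear_order_max[OF linear_ord_of, of ?A] finite_Int finite_greaterThanAtMost_int by blast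
  have "(z, w) \<in> r" if z: "z \<in> right_set D a" for z
  proof (cases "z \<in> ?A")
    case False
    then have "a + n < z" using z less by (force simp: right_set_def)
    have "(a, a + n) \<in> D" using z longI[of a z] \<open>a + n < z\<close> by (simp add: right_set_def)
    then have "(a + n, z) \<in> D" using periodic long_iff \<open>a + n < z\<close> by blast
    then have "(z, a + n) \<in> r" by (simp add: ord_of_def)
    moreover have "(a + n, w) \<in> r" using w(2) \<open>(a, a + n) \<in> D\<close> n_ge_2 by (simp add: right_set_def)
    ultimately show ?thesis by (rule lin(2))
  qed (use w in blast)
  then show ?thesis using w by blast
qed

lemma root_of_eqI: "w \<in> A \<Longrightarrow> (\<And>z. z \<in> A \<Longrightarrow> (z, w) \<in> r) \<Longrightarrow> root_of D A = Some w"
  unfolding root_of_def using lin(3) by (auto intro!: the_equality)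

lemma root_of_iff:
  assumes "A \<noteq> {} \<Longrightarrow> \<exists>w\<in>A. \<forall>z\<in>A. (z, w) \<in> r"
  shows "root_of D A = Some w \<longleftrightarrow> w \<in> A \<and> (\<forall>z\<in>A. (z, w) \<in> r)"
proof (cases "A = {}")
  case False
  with assms obtain v where "v \<in> A" "\<forall>z\<in>A. (z, v) \<in> r" by blast
  then show ?thesis using root_of_eqI by (metis option.inject)
qed (simp add: root_of_def)

lemma lchild_iff: "lchild (tree_of D) a = Some w \<longleftrightarrow> w \<in> left_set D a \<and> (\<forall>z\<in>left_set D a. (z, w) \<in> r)"
  and rchild_iff: "rchild (tree_of D) a = Some w \<longleftrightarrow> w \<in> right_set D a \<and> (\<forall>z\<in>right_set D a. (z, w) \<in> r)"
  using root_of_iff[OF max_in_left] root_of_iff[OF max_in_right] by (simp_all add: tree_of_def)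

lemma subtree_child:
  shows "lchild (tree_of D) a = Some w \<Longrightarrow> subtree w = left_set D a"
    and "rchild (tree_of D) a = Some w \<Longrightarrow> subtree w = right_set D a"
proof -
  have wa: "w \<in> subtree a" if "w \<in> left_set D a \<or> w \<in> right_set D a" using that by (auto simp: subtree_eq)
  {
    assume "lchild (tree_of D) a = Some w"
    then have w: "w \<in> left_set D a" "\<forall>z\<in>left_set D a. (z, w) \<in> r" by (auto simp: lchild_iff)
    have "y \<in> subtree w" if "y \<in> left_set D a" for y
      unfolding subtree_def
    proof (clarify)
      fix z assume "min w y \<le> z" "z \<le> max w y"
      then have "z \<in> left_set D a" using w(1) that by (auto simp: left_set_def min_def max_def split: if_splits)
      then show "(z, w) \<in> r" using w(2) by blast
    qed
    then show "subtree w = left_set D a" using same_side(1) wa w(1) by blast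
  }
  {
    assume "rchild (tree_of D) a = Some w"
    then have w: "w \<in> right_set D a" "\<forall>z\<in>right_set D a. (z, w) \<in> r" by (auto simp: rchild_iff)
    have "y \<in> subtree w" if "y \<in> right_set D a" for y
      unfolding subtree_def
    proof (clarify)
      fix z assume z: "min w y \<le> z" "z \<le> max w y"
      have aw: "(a, max w y) \<in> D" using w(1) that by (auto simp: right_set_def max_def)
      have "a < z" using w(1) that z less[of a w] less[of a y] by (auto simp: right_set_def)
      then have "z \<in> right_set D a" using z(2) aw convex[OF aw, of z] by (cases "z = max w y") (auto simp: right_set_def)
      then show "(z, w) \<in> r" using w(2) by blast
    qed
    then show "subtree w = right_set D a" using same_side(2) wa w(1) by blast
  }
qed

lemma child_cases:
  assumes "(a, w) \<in> child_rel (tree_of D)"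
  shows "w \<in> subtree a" "w \<noteq> a" "a \<notin> subtree w"
    "w \<in> left_set D a \<Longrightarrow> subtree w = left_set D a" "w \<in> right_set D a \<Longrightarrow> subtree w = right_set D a"
proof -
  have c: "w \<in> left_set D a \<and> subtree w = left_set D a \<or> w \<in> right_set D a \<and> subtree w = right_set D a"
    using assms subtree_child[of a w] by (auto simp: child_rel_def lchild_iff rchild_iff)
  then show "w \<in> subtree a" by (auto simp: subtree_eq)
  show "w \<noteq> a" "a \<notin> subtree w" using c by (auto simp: left_set_eq right_set_eq)
  show "w \<in> left_set D a \<Longrightarrow> subtree w = left_set D a" "w \<in> right_set D a \<Longrightarrow> subtree w = right_set D a"
    using c by (auto simp: left_set_eq right_set_eq)
qed

text \<open>The ancestors of \<open>y\<close> below \<open>c\<close> in the tree form a finite set, so the path from \<open>c\<close> down to \<open>y\<close> ends.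
  One far to the left of \<open>y\<close> would have an infinite right subtree and contain \<open>c\<close>; for one far to the
  right, a translate of \<open>c\<close> between \<open>y\<close> and it would have it in its right subtree, separating it from \<open>y\<close>.\<close>

lemma ancestors_bounded:
  assumes "y \<in> subtree z" "z \<in> subtree c"
  shows "min c (y - n) \<le> z \<and> z \<le> max c (y + n)"
proof (rule conjI; rule ccontr)
  assume "\<not> min c (y - n) \<le> z"
  then have z: "z < c" "z + n < y" by auto
  then have "(z, y) \<in> D" using assms(1) n_ge_2 subtree_up[of z y] by simp
  then have "(z, c) \<in> D" using longI[of z y] long_iff[of z c] z by simp
  moreover have "(z, c) \<notin> D" using assms(2) z subtree_down[of z c] by simp
  ultimately show False by blast
next
  assume "\<not> z \<le> max c (y + n)"
  then have z: "c < z" "y + n < z" by auto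
  then have cz: "(c, z) \<in> D" using assms(2) subtree_up[of c z] by simp
  have y: "(w, z) \<notin> D" if "y \<le> w" "w < z" for w
    using assms(1) z that n_ge_2 subtree_down[of y z] by simp
  then have "c < y" using z cz by (meson linorder_not_less)
  then have "(c, c + n) \<in> D" using longI[OF cz] z by linarith
  moreover obtain m where m: "y \<le> c + m * n" "c + m * n < y + n"
    using representative_above n_ge_2 by (metis less_le_trans zero_less_numeral)
  ultimately have "(c + m * n, z) \<in> D" using long_shift[of c m] long_iff[of "c + m * n" z] z by simp
  then show False using y m z by simp
qed

text \<open>Induction on the number of ancestors of \<open>y\<close> inside \<open>subtree a\<close>: passing to the child whose
  subtree contains \<open>y\<close> removes \<open>a\<close> from that set.\<close>

lemma descendants_tree_of: "descendants (tree_of D) a = subtree a"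
proof
  let ?C = "child_rel (tree_of D)"
  show "descendants (tree_of D) a \<subseteq> subtree a"
  proof
    fix y assume "y \<in> descendants (tree_of D) a"
    then have "(a, y) \<in> ?C\<^sup>*" by (simp add: descendants_def)
    then show "y \<in> subtree a"
      by (induction rule: converse_rtrancl_induct) (use subtree_self subtree_trans child_cases(1) in blast)+
  qed
  show "subtree a \<subseteq> descendants (tree_of D) a"
  proof
    fix y assume "y \<in> subtree a"
    then show "y \<in> descendants (tree_of D) a"
    proof (induction "card {z. y \<in> subtree z \<and> z \<in> subtree a}" arbitrary: a rule: less_induct)
      case less
      show ?case
      proof (cases "y = a")
        case False
        then have "\<exists>w. (a, w) \<in> ?C \<and> y \<in> subtree w"
        proof (cases "y \<in> left_set D a")
          case True
          then obtain w where "lchild (tree_of D) a = Some w" using max_in_left lchild_iff by blast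
          then show ?thesis using subtree_child True by (auto simp: child_rel_def)
        next
          case False
          then have y: "y \<in> right_set D a" using less.prems \<open>y \<noteq> a\<close> by (simp add: subtree_eq)
          then obtain w where "rchild (tree_of D) a = Some w" using max_in_right rchild_iff by blast
          then show ?thesis using subtree_child y by (auto simp: child_rel_def)
        qed
        then obtain w where w: "(a, w) \<in> ?C" "y \<in> subtree w" by blast
        note c = child_cases[OF w(1)]
        have "{z. y \<in> subtree z \<and> z \<in> subtree w} \<subset> {z. y \<in> subtree z \<and> z \<in> subtree a}"
          using c(1,3) less.prems subtree_self[of a] subtree_trans by blast
        moreover have "finite {z. y \<in> subtree z \<and> z \<in> subtree a}"
          by (rule finite_subset[of _ "{min a (y - n)..max a (y + n)}"]) (use ancestors_bounded in auto)
        ultimately have "y \<in> descendants (tree_of D) w" using w(2) by (intro less.hyps psubset_card_mono)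
        then show ?thesis using w(1) by (simp add: descendants_def converse_rtrancl_into_rtrancl)
      qed (simp add: descendants_def)
    qed
  qed
qed

lemma left_subtree_tree_of: "left_subtree (tree_of D) a = left_set D a"
proof (cases "lchild (tree_of D) a")
  case None
  then have "left_set D a = {}" using max_in_left lchild_iff by (metis option.distinct(1))
  with None show ?thesis by (simp add: left_subtree_def)
qed (simp add: left_subtree_def descendants_tree_of subtree_child)

lemma right_subtree_tree_of: "right_subtree (tree_of D) a = right_set D a"
proof (cases "rchild (tree_of D) a")
  case None
  then have "right_set D a = {}" using max_in_right rchild_iff by (metis option.distinct(1))
  with None show ?thesis by (simp add: right_subtree_def)
qed (simp add: right_subtree_def descendants_tree_of subtree_child)

text \<open>The largest element of a finite range of integers in \<open>r\<close> is a common ancestor of its ends.\<close>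

lemma binary_tree_tree_of: "binary_tree (tree_of D)"
proof -
  let ?C = "child_rel (tree_of D)"
  have eq: "u = v" if "u \<in> subtree v" "(u, w) \<in> ?C" "(v, w) \<in> ?C" for u v w
  proof (rule ccontr)
    assume "u \<noteq> v"
    note u = child_cases[OF that(2)] and v = child_cases[OF that(3)]
    have "u \<in> subtree w" using same_side[OF u(1) that(1)] v(4,5) that(1) \<open>u \<noteq> v\<close> by (auto simp: subtree_eq[of v])
    then show False using u by blast
  qed
  have "u = v" if "(u, w) \<in> ?C" "(v, w) \<in> ?C" for u v w
    using eq[OF _ that] eq[OF _ that(2,1)] subtree_chain child_cases(1) that by blast
  moreover have "\<not> (lchild (tree_of D) v = Some w \<and> rchild (tree_of D) v = Some w)" for v w
    by (auto simp: lchild_iff rchild_iff left_set_eq right_set_eq)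
  moreover have "acyclic ?C"
    unfolding acyclic_def
  proof (clarify)
    fix x assume "(x, x) \<in> ?C\<^sup>+"
    then obtain y where y: "(x, y) \<in> ?C" "(y, x) \<in> ?C\<^sup>*" by (meson tranclD)
    then have "x \<in> subtree y" using descendants_tree_of by (auto simp: descendants_def)
    then show False using child_cases[OF y(1)] by blast
  qed
  moreover have "\<exists>w. u \<in> subtree w \<and> v \<in> subtree w" for u v
  proof -
    obtain w where w: "w \<in> {min u v..max u v}" "\<forall>z\<in>{min u v..max u v}. (z, w) \<in> r"
      using finite_linear_order_max[OF linear_ord_of, of "{min u v..max u v}"] finite_atLeastAtMost_int
      by (metis atLeastAtMost_iff empty_iff max.cobounded1 min.cobounded1)
    have w': "min u v \<le> w" "w \<le> max u v" using w(1) by auto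
    have "x \<in> subtree w" if "x = u \<or> x = v" for x
      unfolding subtree_def
    proof (clarify)
      fix z assume z: "min w x \<le> z" "z \<le> max w x"
      have "min u v \<le> z \<and> z \<le> max u v" using that w' z by linarith
      then show "(z, w) \<in> r" using w(2) by simp
    qed
    then show ?thesis by blast
  qed
  ultimately show ?thesis unfolding binary_tree_def descendants_tree_of by blast
qed

lemma post_order_tree_of: "post_order (tree_of D) = r"
proof -
  have "(x, y) \<in> r" if "x \<in> left_set D v" "y \<in> right_set D v" for x y v
  proof -
    have "x < v" "v < y" "(x, v) \<notin> D" using that less by (auto simp: left_set_def right_set_def)
    then show ?thesis using convex by (auto simp: ord_of_def)
  qed
  moreover have "(x, v) \<in> r" if "x \<in> left_set D v \<union> right_set D v" for x v
    using that subD[of x v x] by (auto simp: left_set_eq right_set_eq)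
  ultimately have "is_post_order (tree_of D) r"
    using linear_ord_of by (auto simp: is_post_order_def left_subtree_tree_of right_subtree_tree_of)
  then show ?thesis
    unfolding post_order_def using ex1_post_order[OF binary_tree_tree_of] by (simp add: the1_equality)
qed

lemma in_order_tree_of: "in_order (tree_of D) = {(a, b). a \<le> b}"
proof -
  have "linear_order {(a :: int, b). a \<le> b}"
    by (auto simp: linear_order_on_def partial_order_on_def preorder_on_def refl_on_def trans_def antisym_def total_on_def)
  then have "is_in_order (tree_of D) {(a, b). a \<le> b}"
    by (auto simp: is_in_order_def left_subtree_tree_of right_subtree_tree_of left_set_eq right_set_eq)
  then show ?thesis
    unfolding in_order_def using ex1_in_order[OF binary_tree_tree_of] by (simp add: the1_equality)
qed

lemma translate_root:
  assumes "\<And>y. y \<in> A \<longleftrightarrow> y + n \<in> B"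
  shows "(w \<in> A \<and> (\<forall>z\<in>A. (z, w) \<in> r)) \<longleftrightarrow> (w + n \<in> B \<and> (\<forall>z\<in>B. (z, w + n) \<in> r))"
proof -
  have r: "(z, w) \<in> r \<longleftrightarrow> (z + n, w + n) \<in> r" for z using tito_ord_of unfolding tito_def by blast
  have "(\<forall>z\<in>A. (z, w) \<in> r) \<longleftrightarrow> (\<forall>z\<in>B. (z, w + n) \<in> r)"
    using assms r by (metis diff_add_cancel)
  then show ?thesis using assms by blast
qed

lemma tibit_tree_of: "tibit n (tree_of D)"
proof -
  have "y \<in> right_set D a \<longleftrightarrow> y + n \<in> right_set D (a + n)" for a y
    using periodic by (simp add: right_set_def)
  then have right: "(w \<in> right_set D a \<and> (\<forall>z\<in>right_set D a. (z, w) \<in> r)) \<longleftrightarrow>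
      (w + n \<in> right_set D (a + n) \<and> (\<forall>z\<in>right_set D (a + n). (z, w + n) \<in> r))" for a w
    by (rule translate_root)
  have "y \<in> left_set D a \<longleftrightarrow> y + n \<in> left_set D (a + n)" for a y
  proof -
    have "(\<forall>z. y \<le> z \<and> z < a \<longrightarrow> (z, a) \<notin> D) \<longleftrightarrow> (\<forall>z. y + n \<le> z \<and> z < a + n \<longrightarrow> (z, a + n) \<notin> D)"
      (is "?L \<longleftrightarrow> ?R")
    proof
      assume ?L
      then show ?R using periodic[of _ a] by (metis add_less_cancel_right add_le_cancel_right diff_add_cancel)
    next
      assume ?R
      then show ?L using periodic[of _ a] by (metis add_less_cancel_right add_le_cancel_right)
    qed
    then show ?thesis by (simp add: left_set_def)
  qed
  then have left: "(w \<in> left_set D a \<and> (\<forall>z\<in>left_set D a. (z, w) \<in> r)) \<longleftrightarrow>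
      (w + n \<in> left_set D (a + n) \<and> (\<forall>z\<in>left_set D (a + n). (z, w + n) \<in> r))" for a w
    by (rule translate_root)
  have "a < b \<longleftrightarrow> (a, b) \<in> {(a, b). a \<le> b} \<and> a \<noteq> b" for a b :: int by auto
  then show ?thesis
    unfolding tibit_def lchild_iff rchild_iff in_order_tree_of
    by (intro conjI allI binary_tree_tree_of left right)
qed

end


section \<open>Every tree is the tree of its inversions\<close>

context
  fixes n :: int and T :: "int bintree"
  assumes n: "n \<ge> 2" and T: "tibit n T"
begin

lemma tibit_binary_tree: "binary_tree T"
  using T by (simp add: tibit_def)

lemma left_less: "x \<in> left_subtree T v \<Longrightarrow> x < v" and right_greater: "x \<in> right_subtree T v \<Longrightarrow> v < x"
proof -
  have "is_in_order T (in_order T)"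
    unfolding in_order_def using ex1_in_order[OF tibit_binary_tree] by (rule theI')
  then have "x \<in> left_subtree T v \<Longrightarrow> (x, v) \<in> in_order T" "x \<in> right_subtree T v \<Longrightarrow> (v, x) \<in> in_order T"
    unfolding is_in_order_def by blast+
  moreover have "a < b \<longleftrightarrow> (a, b) \<in> in_order T \<and> a \<noteq> b" for a b
    using T unfolding tibit_def by blast
  ultimately show "x \<in> left_subtree T v \<Longrightarrow> x < v" "x \<in> right_subtree T v \<Longrightarrow> v < x"
    using left_self[OF tibit_binary_tree] right_self[OF tibit_binary_tree] by blast+
qed

lemma is_post_order_post_order: "is_post_order T (post_order T)"
  unfolding post_order_def using ex1_post_order[OF tibit_binary_tree] by (rule theI')

lemma linear_post: "linear_order (post_order T)"
  using is_post_order_post_order by (simp add: is_post_order_def)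

lemmas post_order_lin = linear_orderD[OF linear_post]

lemma left_right_post: "x \<in> left_subtree T v \<Longrightarrow> y \<in> right_subtree T v \<Longrightarrow> (x, y) \<in> post_order T"
  and left_post: "x \<in> left_subtree T v \<Longrightarrow> (x, v) \<in> post_order T"
  and right_post: "x \<in> right_subtree T v \<Longrightarrow> (x, v) \<in> post_order T"
  using is_post_order_post_order by (auto simp: is_post_order_def)

text \<open>The general position of two nodes, with the alternatives excluded by \<open>a < b\<close> removed.\<close>

lemma less_cases:
  assumes "a < b"
  shows "a \<in> left_subtree T b \<or> b \<in> right_subtree T a \<or> (\<exists>v. a \<in> left_subtree T v \<and> b \<in> right_subtree T v)"
  using trichotomy[OF tibit_binary_tree, of a b] assms left_less right_greater
  by (metis less_asym less_irrefl less_trans)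

text \<open>Both subtrees are determined by the in-order, which is \<open><\<close>, and the post-order.\<close>

lemma right_subtree_eq: "right_subtree T a = {y. a < y \<and> (y, a) \<in> post_order T}"
proof -
  have "y \<in> right_subtree T a" if "a < y" "(y, a) \<in> post_order T" for y
  proof -
    have "(a, y) \<notin> post_order T" using that post_order_lin(3) by (metis less_irrefl)
    then show ?thesis using less_cases[OF that(1)] left_post left_right_post by blast
  qed
  then show ?thesis using right_greater right_post by blast
qed

lemma left_subtree_eq: "left_subtree T a = {y. y < a \<and> (\<forall>z. y \<le> z \<and> z < a \<longrightarrow> (z, a) \<in> post_order T)}"
proof -
  have "y \<in> left_subtree T a" if "y < a" "\<And>z. y \<le> z \<Longrightarrow> z < a \<Longrightarrow> (z, a) \<in> post_order T" for y
  proof -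
    have "(a, z) \<notin> post_order T" if "y \<le> z" "z < a" for z
      using that \<open>\<And>z. y \<le> z \<Longrightarrow> z < a \<Longrightarrow> (z, a) \<in> post_order T\<close> post_order_lin(3) by (metis less_irrefl)
    then have "a \<notin> right_subtree T z" if "y \<le> z" "z < a" for z using right_post that by blast
    then show ?thesis using less_cases[OF that(1)] left_less right_greater that(1)
      by (metis order.strict_implies_order order_refl)
  qed
  moreover have "(z, a) \<in> post_order T" if "y \<in> left_subtree T a" "y \<le> z" "z < a" for y z
  proof -
    have "a \<notin> right_subtree T z"
    proof
      assume a: "a \<in> right_subtree T z"
      have "y \<in> descendants T a" using left_desc[OF tibit_binary_tree that(1)] .
      then have "y \<in> right_subtree T z" using right_down[OF tibit_binary_tree a] by blast
      then show False using right_greater that(2) by fastforce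
    qed
    then show ?thesis using less_cases[OF that(3)] left_post left_right_post by blast
  qed
  ultimately show ?thesis using left_less by blast
qed

lemma translate_descendants: "w \<in> descendants T v \<longleftrightarrow> w + n \<in> descendants T (v + n)"
proof -
  have ch: "(v, w) \<in> child_rel T \<longleftrightarrow> (v + n, w + n) \<in> child_rel T" for v w
    using T unfolding tibit_def child_rel_def by blast
  have "(v, w) \<in> (child_rel T)\<^sup>* \<Longrightarrow> (v + n, w + n) \<in> (child_rel T)\<^sup>*" for v w
  proof (induction rule: rtrancl_induct)
    case (step y z)
    then have "(y + n, z + n) \<in> child_rel T" using ch[of y z] by blast
    with step.IH show ?case by (rule rtrancl_into_rtrancl)
  qed simp
  moreover have "(v, w) \<in> (child_rel T)\<^sup>* \<Longrightarrow> (v - n, w - n) \<in> (child_rel T)\<^sup>*" for v w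
  proof (induction rule: rtrancl_induct)
    case (step y z)
    then have "(y - n, z - n) \<in> child_rel T" using ch[of "y - n" "z - n"] by simp
    with step.IH show ?case by (rule rtrancl_into_rtrancl)
  qed simp
  ultimately show ?thesis unfolding descendants_def by (metis add_diff_cancel_right' mem_Collect_eq)
qed

lemma translate_right_subtree: "w \<in> right_subtree T v \<longleftrightarrow> w + n \<in> right_subtree T (v + n)"
proof -
  have rc: "rchild T v = Some u \<longleftrightarrow> rchild T (v + n) = Some (u + n)" for u
    using T unfolding tibit_def by blast
  show ?thesis
  proof (cases "rchild T v")
    case None
    then have "rchild T (v + n) \<noteq> Some u" for u using rc[of "u - n"] by simp
    then have "rchild T (v + n) = None" by (cases "rchild T (v + n)") auto
    with None show ?thesis by (simp add: right_subtree_def)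
  next
    case (Some u)
    then show ?thesis using rc[of u] translate_descendants[of w u] by (simp add: right_subtree_def)
  qed
qed

lemma tito_post_order: "tito n (post_order T)"
proof -
  have down: "(b, a) \<in> post_order T \<longleftrightarrow> (b + n, a + n) \<in> post_order T" if "a < b" for a b
    using translate_right_subtree[of b a] that by (simp add: right_subtree_eq)
  have "(a, b) \<in> post_order T \<longleftrightarrow> (b, a) \<notin> post_order T" if "a \<noteq> b" for a b
    using that post_order_lin(3,4) by blast
  then have "(a, b) \<in> post_order T \<longleftrightarrow> (a + n, b + n) \<in> post_order T" for a b
    using down[of a b] down[of b a] post_order_lin(1) by (cases a b rule: linorder_cases) (metis add_right_cancel less_irrefl)+
  then show ?thesis using linear_post by (simp add: tito_def)
qed

text \<open>If \<open>c\<close> is in the right subtree of \<open>a\<close> and \<open>b\<close> is not, then some \<open>v \<le> b\<close> has \<open>a\<close>, and with it \<open>c\<close>, in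
  its left subtree; so \<open>c < b\<close>.\<close>

lemma avoids_312_post_order: "avoids_312 (post_order T)"
  unfolding avoids_312_def
proof (clarify)
  fix a b c assume abc: "a < b" "b < c" "(c, a) \<in> post_order T" "(a, b) \<in> post_order T"
  then have c: "c \<in> right_subtree T a" by (simp add: right_subtree_eq)
  have "b \<notin> right_subtree T a" using abc(1,4) right_post post_order_lin(3) by (metis less_irrefl)
  then have "a \<in> left_subtree T b \<or> (\<exists>v. a \<in> left_subtree T v \<and> b \<in> right_subtree T v)"
    using less_cases[OF abc(1)] by blast
  then obtain v where v: "a \<in> left_subtree T v" "v \<le> b" using right_greater by fastforce
  have "c \<in> left_subtree T v" using left_down[OF tibit_binary_tree v(1)] right_desc[OF tibit_binary_tree c] by blast
  then show False using left_less v(2) abc(2) by fastforce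
qed

lemma tamari_post_order: "tamari n (inversions (post_order T))"
  by (rule tamari_inversions[OF n tito_post_order avoids_312_post_order])

text \<open>A child is recovered as the last element, in post-order, of the corresponding subtree.\<close>

lemma tree_of_post_order: "tree_of (inversions (post_order T)) = T"
proof -
  let ?D = "inversions (post_order T)"
  have ord: "ord_of ?D = post_order T" by (rule ord_of_inversions[OF linear_post])
  have right: "right_set ?D a = right_subtree T a" for a
    by (auto simp: right_set_def right_subtree_eq inversions_def)
  have "(z, a) \<notin> ?D \<longleftrightarrow> (z, a) \<in> post_order T" if "z < a" for z a
    using that post_order_lin(3)[of z a] post_order_lin(4)[of z a] by (auto simp: inversions_def)
  then have left: "left_set ?D a = left_subtree T a" for a
    unfolding left_set_def left_subtree_eq by blast
  have root: "root_of ?D (descendants T w) = Some w" for w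
  proof (rule tamari.root_of_eqI[OF tamari_post_order])
    show "w \<in> descendants T w" by (rule desc_refl[OF tibit_binary_tree])
    show "(z, w) \<in> ord_of ?D" if "z \<in> descendants T w" for z
      using that left_post right_post post_order_lin(1) unfolding ord desc_cases[OF tibit_binary_tree] by blast
  qed
  have "root_of ?D (left_subtree T a) = lchild T a" for a
    by (cases "lchild T a") (simp_all add: left_subtree_def root, simp add: root_of_def)
  moreover have "root_of ?D (right_subtree T a) = rchild T a" for a
    by (cases "rchild T a") (simp_all add: right_subtree_def root, simp add: root_of_def)
  ultimately show ?thesis by (simp add: tree_of_def left right)
qed

end


section \<open>The projection on trees\<close>

lemma root_of_cong:
  assumes "\<And>x y. x \<in> A \<Longrightarrow> y \<in> A \<Longrightarrow> (x, y) \<in> D \<longleftrightarrow> (x, y) \<in> E"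
  shows "root_of D A = root_of E A"
proof -
  have "(x, y) \<in> ord_of D \<longleftrightarrow> (x, y) \<in> ord_of E" if "x \<in> A" "y \<in> A" for x y
    using that assms by (simp add: ord_of_def)
  then have "(\<lambda>w. w \<in> A \<and> (\<forall>z\<in>A. (z, w) \<in> ord_of D)) = (\<lambda>w. w \<in> A \<and> (\<forall>z\<in>A. (z, w) \<in> ord_of E))"
    by auto
  then show ?thesis by (simp add: root_of_def)
qed

lemma left_set_above: "y \<in> left_set D a \<Longrightarrow> (z, a) \<in> D \<Longrightarrow> z < a \<Longrightarrow> z < y"
  unfolding left_set_def by (metis (mono_tags, lifting) linorder_not_less mem_Collect_eq)

context tamari
begin

text \<open>As \<open>k - n < k\<close>, the child must be a right child, hence the last element in \<open>r\<close> of the right subtree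
  of \<open>k - n\<close>.  A member of another infinite class between \<open>k - n\<close> and \<open>k\<close> would come after \<open>k\<close>, and if
  there is none then all of that right subtree precedes \<open>k\<close>.\<close>

lemma child_iff_lone_class: "(k - n, k) \<in> child_rel (tree_of D) \<longleftrightarrow> lone_class n D k"
proof -
  have "lchild (tree_of D) (k - n) \<noteq> Some k" using n_ge_2 by (auto simp: lchild_iff left_set_def)
  then have "(k - n, k) \<in> child_rel (tree_of D) \<longleftrightarrow>
      (k - n, k) \<in> D \<and> (\<forall>z. (k - n, z) \<in> D \<longrightarrow> (z, k) \<in> r)"
    by (auto simp: child_rel_def rchild_iff right_set_def)
  also have "\<dots> \<longleftrightarrow> lone_class n D k"
  proof
    assume k: "(k - n, k) \<in> D \<and> (\<forall>z. (k - n, z) \<in> D \<longrightarrow> (z, k) \<in> r)"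
    have kk: "(k, k + n) \<in> D" using k periodic[of "k - n" k] by simp
    moreover have "a mod n = k mod n" if a: "(a, a + n) \<in> D" for a
    proof (rule ccontr)
      assume ne: "a mod n \<noteq> k mod n"
      obtain m where m: "k - n \<le> a + m * n" "a + m * n < k - n + n"
        using representative_above n_ge_2 by (metis less_le_trans zero_less_numeral)
      have "a + m * n \<noteq> k - n" using ne by (metis minus_mod_self2 mod_mult_self1)
      then have "(k - n, a + m * n) \<in> D" using convex[of "k - n" k "a + m * n"] k m by auto
      then have "(a + m * n, k) \<in> r" using k by blast
      moreover have "(a + m * n, k) \<in> D" using a long_shift[of a m] long_iff[of "a + m * n" k] m by simp
      ultimately show False using m by (simp add: ord_of_up)
    qed
    ultimately show "lone_class n D k" unfolding lone_class_def by blast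
  next
    assume k: "lone_class n D k"
    then have kk: "(k, k + n) \<in> D" by (simp add: lone_class_def)
    then have "(k - n, k) \<in> D" using periodic[of "k - n" k] by simp
    moreover have "(z, k) \<in> r" if z: "(k - n, z) \<in> D" for z
    proof (cases z k rule: linorder_cases)
      case less
      have "(z, k) \<notin> D"
      proof
        assume "(z, k) \<in> D"
        then have "(z, z + n) \<in> D" using long_up kk by blast
        then have "z mod n = k mod n" using k unfolding lone_class_def by blast
        then have "n dvd k - z" by (metis mod_eq_dvd_iff)
        moreover have "0 < k - z" "k - z < n" using less tamari.less[OF tamari_axioms z] by auto
        ultimately show False by (meson zdvd_not_zless)
      qed
      then show ?thesis using less by (simp add: ord_of_up)
    next
      case greater
      then show ?thesis using long_iff[OF kk greater] by (simp add: ord_of_def)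
    qed (simp add: ord_of_def)
    ultimately show "(k - n, k) \<in> D \<and> (\<forall>z. (k - n, z) \<in> D \<longrightarrow> (z, k) \<in> r)" by blast
  qed
  finally show ?thesis .
qed

lemma real_tibit_tree_of: "real_tibit n (tree_of D) \<longleftrightarrow> real_rel n D"
  by (simp add: real_tibit_def real_rel_def child_iff_lone_class)

text \<open>Truncation changes neither the subtrees nor the children of a node \<open>j\<close> outside the class of \<open>k\<close>:
  its left subtree stays to the right of the last member of that class before \<open>j\<close>.
  For \<open>j\<close> in the class of \<open>k\<close>, everything to the left of \<open>j\<close> becomes its left subtree, with root
  \<open>j - n\<close>; and its right subtree becomes the open interval from \<open>j\<close> to \<open>j + n\<close>, which was the left
  subtree of \<open>j + n\<close> and so has the translate of \<open>k'\<close> as root.\<close>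

lemma pi_spine_tree_of: "pi_spine n (tree_of D) = tree_of (proj n D)"
proof (cases "real_rel n D")
  case True
  then show ?thesis by (simp add: pi_spine_def real_tibit_tree_of proj_real)
next
  case False
  let ?T = "tree_of D" and ?E = "proj n D"
  interpret E: tamari n ?E by (rule tamari_proj[OF tamari_axioms])
  have E_iff: "(a, c) \<in> ?E \<longleftrightarrow> (a, c) \<in> D \<and> c < a + n" for a c using False by (simp add: proj_def)
  define k where "k = (SOME k. (k - n, k) \<in> child_rel ?T)"
  have lone: "lone_class n D k"
    using False someI_ex[of "\<lambda>k. (k - n, k) \<in> child_rel ?T"] by (auto simp: k_def child_iff_lone_class real_rel_def)
  have long: "(j, j + n) \<in> D \<longleftrightarrow> j mod n = k mod n" for j
    using lone long_mod unfolding lone_class_def by metis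
  have not_into: "(z, j) \<notin> D" if "j mod n = k mod n" "z mod n \<noteq> k mod n" for z j
    using that long long_up by blast
  have not_into_near: "(z, j) \<notin> D" if "j mod n = k mod n" "j - n < z" "z < j" for z j
  proof (rule not_into[OF that(1)])
    show "z mod n \<noteq> k mod n"
    proof
      assume "z mod n = k mod n"
      then have "n dvd j - z" using that(1) by (metis mod_eq_dvd_iff)
      moreover have "0 < j - z" "j - z < n" using that(2,3) by auto
      ultimately show False by (meson zdvd_not_zless)
    qed
  qed
  have root_eq: "root_of D A = root_of ?E A" if "\<And>x y. x \<in> A \<Longrightarrow> y \<in> A \<Longrightarrow> y < x + n" for A
    by (rule root_of_cong) (use that E_iff in blast)
  have left: "root_of ?E (left_set ?E j) = (if j mod n = k mod n then Some (j - n) else lchild ?T j)" for j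
  proof (cases "j mod n = k mod n")
    case True
    have E: "(z, j) \<notin> ?E" if "j mod n = k mod n" for z j
    proof
      assume zj: "(z, j) \<in> ?E"
      then have "z < j" "j < z + n" "(z, j) \<in> D" using E_iff less by auto
      then show False using not_into_near[OF that, of z] by simp
    qed
    \<comment> \<open>No pair ends in \<open>j - n\<close>, and \<open>j - n\<close> still reaches all integers strictly between it and \<open>j\<close>.\<close>
    have "root_of ?E {..<j} = Some (j - n)"
    proof (rule E.root_of_eqI)
      fix z assume z: "z \<in> {..<j}"
      show "(z, j - n) \<in> ord_of ?E"
      proof (cases z "j - n" rule: linorder_cases)
        case less
        moreover have "(j - n) mod n = k mod n" using True by simp
        ultimately show ?thesis using E[of "j - n" z] E.ord_of_up[of z "j - n"] by blast
      next
        case greater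
        have "(j - n, j - n + n) \<in> D" using True long[of "j - n"] by simp
        then have "(j - n, z) \<in> ?E" using greater z long_iff[of "j - n" z] E_iff by simp
        then show ?thesis by (simp add: ord_of_def)
      qed (simp add: ord_of_def)
    qed (use n_ge_2 in simp)
    moreover have "left_set ?E j = {..<j}" using E[OF True] by (auto simp: left_set_def)
    ultimately show ?thesis using True by simp
  next
    case False
    \<comment> \<open>The last member of the class of \<open>k\<close> before \<open>j\<close>.\<close>
    obtain m where m: "j - n \<le> k + m * n" "k + m * n < j - n + n"
      using representative_above n_ge_2 by (metis less_le_trans zero_less_numeral)
    let ?k = "k + m * n"
    have k: "?k mod n = k mod n" by simp
    then have "(?k, j) \<in> D" using long long_iff m by (metis diff_add_cancel)
    have "?k \<noteq> j - n" using False k by (metis minus_mod_self2)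
    with \<open>(?k, j) \<in> D\<close> m have "(?k, j) \<in> ?E" using E_iff by simp
    have "?k < j" using m(2) by simp
    have D: "?k < y" if "y \<in> left_set D j" for y
      using left_set_above[OF that \<open>(?k, j) \<in> D\<close> \<open>?k < j\<close>] .
    have E: "?k < y" if "y \<in> left_set ?E j" for y
      using left_set_above[OF that \<open>(?k, j) \<in> ?E\<close> \<open>?k < j\<close>] .
    have "(z, j) \<in> D \<longleftrightarrow> (z, j) \<in> ?E" if "?k < z" for z using that m E_iff by auto
    then have sets: "left_set ?E j = left_set D j"
      using D E unfolding left_set_def by (smt (verit) Collect_cong mem_Collect_eq)
    have "root_of D (left_set D j) = root_of ?E (left_set D j)"
    proof (rule root_eq)
      fix x y assume "x \<in> left_set D j" "y \<in> left_set D j"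
      then have "?k < x" "y < j" using D by (auto simp: left_set_def)
      then show "y < x + n" using m by simp
    qed
    then show ?thesis using sets False by (simp add: tree_of_def)
  qed
  have k': "lchild ?T k = Some (the (lchild ?T k))"
  proof -
    have "k - 1 \<in> left_set D k" using not_into_near[of k] n_ge_2 by (auto simp: left_set_def)
    then show ?thesis by (auto simp: tree_of_def root_of_def)
  qed
  have shift_lchild: "lchild ?T (b + m * n) = Some (a + m * n)" if "lchild ?T b = Some a" for a b m
  proof -
    have "(a + m * n, b + m * n) \<in> {(a, b). lchild ?T b = Some a}"
      by (subst shift_invariant) (use that tibit_tree_of in \<open>auto simp: tibit_def\<close>)
    then show ?thesis by simp
  qed
  have right: "root_of ?E (right_set ?E j) =
      (if j mod n = k mod n then Some (the (lchild ?T k) + ((j - k) div n + 1) * n) else rchild ?T j)" for j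
  proof (cases "j mod n = k mod n")
    case True
    obtain m where m: "j = k + m * n" using True by (rule congruent_shift)
    have "right_set ?E j = {j<..<j + n}"
      using True long[of j] long_iff[of j] E_iff less by (auto simp: right_set_def)
    moreover have "left_set D (j + n) = {j<..<j + n}"
    proof -
      have j: "(j, j + n) \<in> D" using True long by blast
      have "(j + n) mod n = k mod n" using True by simp
      then have "(z, j + n) \<notin> D" if "j < z" "z < j + n" for z using not_into_near that by simp
      then have "y \<in> left_set D (j + n)" if "j < y" "y < j + n" for y using that by (simp add: left_set_def)
      moreover have "j < y \<and> y < j + n" if "y \<in> left_set D (j + n)" for y
        using left_set_above[OF that j] that n_ge_2 by (simp add: left_set_def)
      ultimately show ?thesis by auto
    qed
    ultimately have "root_of ?E (right_set ?E j) = lchild ?T (j + n)"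
      using root_eq[of "{j<..<j + n}"] by (simp add: tree_of_def)
    also have "j + n = k + (m + 1) * n" using m by (simp add: algebra_simps)
    finally show ?thesis using shift_lchild[OF k', of "m + 1"] True m n_ge_2 by simp
  next
    case False
    then have short: "c < j + n" if "(j, c) \<in> D" for c using that longI long by force
    then have sets: "right_set ?E j = right_set D j" using E_iff by (auto simp: right_set_def)
    have "root_of D (right_set D j) = root_of ?E (right_set D j)"
      by (rule root_eq) (use short less in \<open>fastforce simp: right_set_def\<close>)
    then show ?thesis using sets False by (simp add: tree_of_def)
  qed
  have "tree_of ?E = \<lparr>lchild = (\<lambda>j. if j mod n = k mod n then Some (j - n) else lchild ?T j),
      rchild = (\<lambda>j. if j mod n = k mod n then Some (the (lchild ?T k) + ((j - k) div n + 1) * n) else rchild ?T j)\<rparr>"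
    using left right by (simp add: tree_of_def)
  then show ?thesis using False by (simp add: pi_spine_def real_tibit_tree_of Let_def flip: k_def)
qed

end


section \<open>The affine Tamari lattice\<close>

context
  fixes n :: int
  assumes n: "n \<ge> 2"
begin

lemma CTam_Tree_model:
  "set_model (CTam_Tree n) (\<lambda>T. inversions (post_order T)) {D. tamari n D} (tam_join n) (\<inter>)"
proof
  show "eq (CTam_Tree n) = (=)" by (simp add: CTam_Tree_def)
  show "le (CTam_Tree n) S T \<longleftrightarrow> inversions (post_order S) \<subseteq> inversions (post_order T)"
    if "S \<in> carrier (CTam_Tree n)" "T \<in> carrier (CTam_Tree n)" for S T
    using that n by (simp add: CTam_Tree_def dyer_le_iff tito_post_order)
  show "bij_betw (\<lambda>T. inversions (post_order T)) (carrier (CTam_Tree n)) {D. tamari n D}"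
    by (rule bij_betw_byWitness[where f' = tree_of])
      (auto simp: CTam_Tree_def n tree_of_post_order[OF n] tamari_post_order tamari.tibit_tree_of
        tamari.post_order_tree_of tamari.inversions_ord_of)
  fix A B C assume A: "A \<in> {D. tamari n D}" and B: "B \<in> {D. tamari n D}"
  then have AB: "tamari n A" "tamari n B" by simp_all
  show "tam_join n A B \<in> {D. tamari n D} \<and> A \<subseteq> tam_join n A B \<and> B \<subseteq> tam_join n A B"
    using tamari_join[OF AB] join_upper[OF AB] by simp
  show "A \<inter> B \<in> {D. tamari n D} \<and> A \<inter> B \<subseteq> A \<and> A \<inter> B \<subseteq> B" using tamari_Int[OF AB] by simp
  assume "C \<in> {D. tamari n D}"
  then show "A \<subseteq> C \<Longrightarrow> B \<subseteq> C \<Longrightarrow> tam_join n A B \<subseteq> C" using join_least[OF AB] by simp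
  show "C \<subseteq> A \<Longrightarrow> C \<subseteq> B \<Longrightarrow> C \<subseteq> A \<inter> B" by blast
qed

lemma real_operations:
  assumes "A \<in> {D. tamari n D \<and> real_rel n D}" "B \<in> {D. tamari n D \<and> real_rel n D}"
  shows "tam_join n A B \<in> {D. tamari n D \<and> real_rel n D} \<and> A \<subseteq> tam_join n A B \<and> B \<subseteq> tam_join n A B"
    and "C \<in> {D. tamari n D \<and> real_rel n D} \<Longrightarrow> A \<subseteq> C \<Longrightarrow> B \<subseteq> C \<Longrightarrow> tam_join n A B \<subseteq> C"
    and "proj n (A \<inter> B) \<in> {D. tamari n D \<and> real_rel n D} \<and> proj n (A \<inter> B) \<subseteq> A \<and> proj n (A \<inter> B) \<subseteq> B"
    and "C \<in> {D. tamari n D \<and> real_rel n D} \<Longrightarrow> C \<subseteq> A \<Longrightarrow> C \<subseteq> B \<Longrightarrow> C \<subseteq> proj n (A \<inter> B)"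
proof -
  have AB: "tamari n A" "tamari n B" "real_rel n A" "real_rel n B" using assms by simp_all
  note AB' = AB(1,2)
  show "tam_join n A B \<in> {D. tamari n D \<and> real_rel n D} \<and> A \<subseteq> tam_join n A B \<and> B \<subseteq> tam_join n A B"
    using tamari_join[OF AB'] join_upper[OF AB'] real_join[OF AB] by simp
  show "C \<in> {D. tamari n D \<and> real_rel n D} \<Longrightarrow> A \<subseteq> C \<Longrightarrow> B \<subseteq> C \<Longrightarrow> tam_join n A B \<subseteq> C"
    using join_least[OF AB'] by simp
  show "proj n (A \<inter> B) \<in> {D. tamari n D \<and> real_rel n D} \<and> proj n (A \<inter> B) \<subseteq> A \<and> proj n (A \<inter> B) \<subseteq> B"
    using real_meet(1-4)[OF AB'] by simp
  show "C \<in> {D. tamari n D \<and> real_rel n D} \<Longrightarrow> C \<subseteq> A \<Longrightarrow> C \<subseteq> B \<Longrightarrow> C \<subseteq> proj n (A \<inter> B)"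
    using real_meet(5)[OF AB'] by simp
qed

lemma ATam_Tree_model:
  "set_model (ATam_Tree n) (\<lambda>T. inversions (post_order T)) {D. tamari n D \<and> real_rel n D}
     (tam_join n) (\<lambda>D E. proj n (D \<inter> E))"
proof
  show "eq (ATam_Tree n) = (=)" by (simp add: ATam_Tree_def CTam_Tree_def)
  show "le (ATam_Tree n) S T \<longleftrightarrow> inversions (post_order S) \<subseteq> inversions (post_order T)"
    if "S \<in> carrier (ATam_Tree n)" "T \<in> carrier (ATam_Tree n)" for S T
    using that n by (simp add: ATam_Tree_def CTam_Tree_def dyer_le_iff tito_post_order)
  have "real_rel n (inversions (post_order T))" if "tibit n T" "real_tibit n T" for T
    using that tamari.real_tibit_tree_of[OF tamari_post_order[OF n that(1)]] tree_of_post_order[OF n that(1)] by simp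
  then show "bij_betw (\<lambda>T. inversions (post_order T)) (carrier (ATam_Tree n)) {D. tamari n D \<and> real_rel n D}"
    by (intro bij_betw_byWitness[where f' = tree_of])
      (auto simp: ATam_Tree_def CTam_Tree_def n tree_of_post_order[OF n] tamari_post_order tamari.tibit_tree_of
        tamari.post_order_tree_of tamari.inversions_ord_of tamari.real_tibit_tree_of)
qed (fact real_operations)+

lemma ATam_312_model:
  "set_model (ATam_312 n) inversions {D. tamari n D \<and> real_rel n D} (tam_join n) (\<lambda>D E. proj n (D \<inter> E))"
proof
  show "eq (ATam_312 n) = (=)" by (simp add: ATam_312_def)
  show "le (ATam_312 n) r s \<longleftrightarrow> inversions r \<subseteq> inversions s"
    if "r \<in> carrier (ATam_312 n)" "s \<in> carrier (ATam_312 n)" for r s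
    using that by (simp add: ATam_312_def dyer_le_iff)
  have ord: "ord_of (inversions r) = r" if "tito n r" for r
    using that by (simp add: tito_def ord_of_inversions)
  have "real_rel n (inversions r)" if "tito n r" "avoids_312 r" "real_tito n r" for r
    using that tamari.real_tito_ord_of[OF tamari_inversions[OF n that(1,2)]] ord by simp
  then show "bij_betw inversions (carrier (ATam_312 n)) {D. tamari n D \<and> real_rel n D}"
    by (intro bij_betw_byWitness[where f' = ord_of])
      (auto simp: ATam_312_def n ord tamari_inversions tamari.tito_ord_of tamari.avoids_312_ord_of
        tamari.inversions_ord_of tamari.real_tito_ord_of)
qed (fact real_operations)+

lemma pi_spine_model:
  assumes "tibit n T"
  shows "tibit n (pi_spine n T)" "real_tibit n (pi_spine n T)"
    "inversions (post_order (pi_spine n T)) = proj n (inversions (post_order T))"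
proof -
  let ?D = "inversions (post_order T)"
  have D: "tamari n ?D" by (rule tamari_post_order[OF n assms])
  have "pi_spine n T = tree_of (proj n ?D)"
    using tamari.pi_spine_tree_of[OF D] tree_of_post_order[OF n assms] by simp
  then show "tibit n (pi_spine n T)" "real_tibit n (pi_spine n T)"
    "inversions (post_order (pi_spine n T)) = proj n ?D"
    using tamari_proj[OF D] real_proj[of n ?D]
    by (simp_all add: tamari.tibit_tree_of tamari.real_tibit_tree_of tamari.post_order_tree_of tamari.inversions_ord_of)
qed

end

theorem theorem4p15:
  fixes n :: int
  assumes "n \<ge> 2"
  shows "finite_lattice (ATam_Tree n)
       \<and> finite_lattice (ATam_312 n)
       \<and> lattice_hom (CTam_Tree n) (ATam_Tree n) (pi_spine n)
       \<and> pi_spine n ` carrier (CTam_Tree n) = carrier (ATam_Tree n)"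
proof (intro conjI)
  let ?F = "{D. tamari n D \<and> real_rel n D}"
  have F: "finite ?F" "?F \<noteq> {}"
    using finite_tamari[of n] tamari_empty[OF assms] by (auto simp: real_rel_def lone_class_def)
  show "finite_lattice (ATam_Tree n)"
    by (rule set_model.finite_lattice[OF ATam_Tree_model[OF assms] F])
  show "finite_lattice (ATam_312 n)"
    by (rule set_model.finite_lattice[OF ATam_312_model[OF assms] F])
  show "lattice_hom (CTam_Tree n) (ATam_Tree n) (pi_spine n)"
  proof (rule lattice_hom_modelI[OF CTam_Tree_model[OF assms] ATam_Tree_model[OF assms], where p = "proj n"])
    show "pi_spine n T \<in> carrier (ATam_Tree n) \<and>
        inversions (post_order (pi_spine n T)) = proj n (inversions (post_order T))"
      if "T \<in> carrier (CTam_Tree n)" for T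
      using that pi_spine_model[OF assms] by (simp add: ATam_Tree_def CTam_Tree_def)
  qed (simp_all add: proj_join proj_Int)
  show "pi_spine n ` carrier (CTam_Tree n) = carrier (ATam_Tree n)"
  proof
    show "pi_spine n ` carrier (CTam_Tree n) \<subseteq> carrier (ATam_Tree n)"
      using pi_spine_model[OF assms] by (auto simp: ATam_Tree_def CTam_Tree_def)
    have "T = pi_spine n T" if "T \<in> carrier (ATam_Tree n)" for T
      using that by (simp add: ATam_Tree_def pi_spine_def)
    then show "carrier (ATam_Tree n) \<subseteq> pi_spine n ` carrier (CTam_Tree n)"
      by (auto simp: ATam_Tree_def CTam_Tree_def)
  qed
qed

end
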